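(* Let $\Delta\ge2$ and $q\ge1$ be integers, and consider $q$-edge coloring instances (every list equal to $[q]$) on trees of maximum degree $\Delta$. Let $\varepsilon=\max\{\frac{\Delta-1}{\Delta},\frac{e-1}{e}\}$, where $e$ is Euler's number. (1) If $q\ge2\Delta-1$, there is a constant $C=C(q,\Delta)$ such that the uniform distribution over proper $q$-edge colorings of every tree of maximum degree $\Delta$ satisfies weak spatial mixing with exponential decay rate $1-\frac{1-\varepsilon}{2\Delta-(1+\varepsilon)}$ and constant $C$. (2) If $q\le2\Delta-2$, weak spatial mixing fails: there do not exist constants $C>0$ and $\gamma\in(0,1)$ such that the uniform distribution over proper $q$-edge colorings of every tree of maximum degree $\Delta$ satisfies weak spatial mixing with rate $1-\gamma$ and constant $C$.
   Context: A proper $q$-edge coloring of a tree $T=(V,E)$ is $\sigma:E\to[q]$ with distinct colors on distinct edges sharing an endpoint; $\mu$ is the uniform distribution on them; for a pinning $\tau$ on $\Lambda\subseteq E$, $\mu^\tau_e$ is the marginal on edge $e$ conditioned on agreeing with $\tau$ on $\Lambda$; a pinning is feasible if it extends to a proper coloring. For edges $e,e'$, $\mathrm{dist}_T(e,e')$ is the length of a shortest path between them not containing $e,e'$. Weak spatial mixing with rate $1-\gamma$ and constant $C$: for every $e\in E$, every $\Lambda\subseteq E\setminus\{e\}$ and all feasible pinnings $\sigma,\tau$ on $\Lambda$, $\|\mu^\sigma_e-\mu^\tau_e\|_{TV}\le C(1-\gamma)^K$ with $K=\min_{e'\in\Lambda}\mathrm{dist}_T(e,e')$. (The constants are meant to be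 uniform over the class of instances.)
   Formalization: Weak spatial mixing is taken to include that a proper q-edge coloring exists; otherwise, for q<Δ, no tree of maximum degree Δ has a coloring, mixing holds vacuously and (2) fails. Trees are finite with natural numbers as vertices. *)

theory Defs
  imports "HOL-Probability.Probability"
begin

text \<open>A graph is given by its vertex set \<open>V\<close> and its set \<open>E\<close> of two-element edges.
  The predicate \<open>tree\<close> of the AFP entry Graph_Theory only excludes \<^emph>\<open>directed\<close> cycles of a
  digraph, so it is not the notion of an undirected tree needed here.\<close>

definition simple_graph :: "'v set \<Rightarrow> 'v set set \<Rightarrow> bool" where
  "simple_graph V E \<longleftrightarrow> finite V \<and> V \<noteq> {} \<and> (\<forall>e\<in>E. e \<subseteq> V \<and> card e = 2)"

definition path_edges :: "'v list \<Rightarrow> 'v set set" where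
  "path_edges xs = {{xs ! i, xs ! Suc i} | i. Suc i < length xs}"

definition is_path :: "'v set \<Rightarrow> 'v set set \<Rightarrow> 'v list \<Rightarrow> bool" where
  "is_path V E xs \<longleftrightarrow> xs \<noteq> [] \<and> distinct xs \<and> set xs \<subseteq> V \<and> path_edges xs \<subseteq> E"

text \<open>The number of edges; a single vertex is a path of length 0.\<close>

definition path_length :: "'v list \<Rightarrow> nat" where
  "path_length xs = length xs - 1"

definition graph_connected :: "'v set \<Rightarrow> 'v set set \<Rightarrow> bool" where
  "graph_connected V E \<longleftrightarrow> (\<forall>u\<in>V. \<forall>v\<in>V. \<exists>xs. is_path V E xs \<and> hd xs = u \<and> last xs = v)"

definition graph_acyclic :: "'v set \<Rightarrow> 'v set set \<Rightarrow> bool" where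
  "graph_acyclic V E \<longleftrightarrow>
     \<not> (\<exists>xs. is_path V E xs \<and> length xs \<ge> 3 \<and> {last xs, hd xs} \<in> E)"

definition is_tree :: "'v set \<Rightarrow> 'v set set \<Rightarrow> bool" where
  "is_tree V E \<longleftrightarrow> simple_graph V E \<and> graph_connected V E \<and> graph_acyclic V E"

definition vertex_degree :: "'v set set \<Rightarrow> 'v \<Rightarrow> nat" where
  "vertex_degree E v = card {e \<in> E. v \<in> e}"

definition max_degree :: "'v set \<Rightarrow> 'v set set \<Rightarrow> nat" where
  "max_degree V E = Max (vertex_degree E ` V)"

text \<open>Edges sharing an endpoint are at distance 0.\<close>

definition edge_dist :: "'v set \<Rightarrow> 'v set set \<Rightarrow> 'v set \<Rightarrow> 'v set \<Rightarrow> nat" where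
  "edge_dist V E e e' = (LEAST n. \<exists>xs. is_path V E xs \<and> hd xs \<in> e \<and> last xs \<in> e' \<and>
     e \<notin> path_edges xs \<and> e' \<notin> path_edges xs \<and> path_length xs = n)"

text \<open>Colorings are extensional functions (undefined off \<open>E\<close>), so distinct members of this set
  are distinct colorings of \<open>E\<close>.\<close>

definition proper_colorings :: "nat \<Rightarrow> 'v set set \<Rightarrow> ('v set \<Rightarrow> nat) set" where
  "proper_colorings q E =
     {\<sigma> \<in> E \<rightarrow>\<^sub>E {1..q}. \<forall>e\<in>E. \<forall>f\<in>E. e \<noteq> f \<longrightarrow> e \<inter> f \<noteq> {} \<longrightarrow> \<sigma> e \<noteq> \<sigma> f}"

definition agreeing :: "'v set set \<Rightarrow> ('v set \<Rightarrow> nat) \<Rightarrow> ('v set \<Rightarrow> nat) set" where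
  "agreeing \<Lambda> \<tau> = {\<sigma>. \<forall>e\<in>\<Lambda>. \<sigma> e = \<tau> e}"

definition feasible_pinnings :: "nat \<Rightarrow> 'v set set \<Rightarrow> 'v set set \<Rightarrow> ('v set \<Rightarrow> nat) set" where
  "feasible_pinnings q E \<Lambda> =
     {\<tau> \<in> \<Lambda> \<rightarrow>\<^sub>E {1..q}. proper_colorings q E \<inter> agreeing \<Lambda> \<tau> \<noteq> {}}"

definition uniform_coloring :: "nat \<Rightarrow> 'v set set \<Rightarrow> ('v set \<Rightarrow> nat) pmf" where
  "uniform_coloring q E = pmf_of_set (proper_colorings q E)"

definition pinned_marginal ::
    "nat \<Rightarrow> 'v set set \<Rightarrow> 'v set set \<Rightarrow> ('v set \<Rightarrow> nat) \<Rightarrow> 'v set \<Rightarrow> nat pmf" where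
  "pinned_marginal q E \<Lambda> \<tau> e =
     map_pmf (\<lambda>\<sigma>. \<sigma> e) (cond_pmf (uniform_coloring q E) (agreeing \<Lambda> \<tau>))"

definition tv_dist :: "'a pmf \<Rightarrow> 'a pmf \<Rightarrow> real" where
  "tv_dist p r = (SUP A. \<bar>measure_pmf.prob p A - measure_pmf.prob r A\<bar>)"

text \<open>Decay rate \<open>1 - \<gamma>\<close>, constant \<open>C\<close>. For \<open>\<Lambda> = {}\<close> the minimum is over the empty set, and there is
  only the empty pinning, so that case imposes no condition and is left out.

  The first conjunct says that the uniform distribution exists. Without proper colorings there is
  no feasible pinning, and the second conjunct alone would hold vacuously although there is no
  distribution to speak of; for instance for every tree with a vertex of degree larger than \<open>q\<close>.\<close>

definition weak_spatial_mixing :: "nat \<Rightarrow> 'v set \<Rightarrow> 'v set set \<Rightarrow> real \<Rightarrow> real \<Rightarrow> bool" where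
  "weak_spatial_mixing q V E \<gamma> C \<longleftrightarrow>
     proper_colorings q E \<noteq> {} \<and>
     (\<forall>e\<in>E. \<forall>\<Lambda>. \<Lambda> \<subseteq> E - {e} \<longrightarrow> \<Lambda> \<noteq> {} \<longrightarrow>
        (\<forall>\<sigma>\<in>feasible_pinnings q E \<Lambda>. \<forall>\<tau>\<in>feasible_pinnings q E \<Lambda>.
           tv_dist (pinned_marginal q E \<Lambda> \<sigma> e) (pinned_marginal q E \<Lambda> \<tau> e)
             \<le> C * (1 - \<gamma>) ^ Min (edge_dist V E e ` \<Lambda>)))"

end

theory Submission
  imports Defs
begin

text \<open>
  Lower bound on \<open>q\<close>. Cut the tree at an edge \<open>e\<close> and let \<open>W(c)\<close> be the number of colorings of one
  side that give \<open>e\<close> the color \<open>c\<close>. If \<open>W\<^sub>i\<close> are the corresponding counts of the child branches, then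
  \<open>W(c)\<close> is the sum of \<open>\<Prod> W\<^sub>i(c\<^sub>i)\<close> over distinct colors \<open>c\<^sub>i \<noteq> c\<close>. In \<open>W(c) - W(c')\<close> the terms avoiding
  both \<open>c\<close> and \<open>c'\<close> cancel, and what is left is \<open>\<Sum>\<^sub>i (W\<^sub>i(c') - W\<^sub>i(c)) U\<^sub>i\<close> with \<open>U\<^sub>i\<close> independent of branch
  \<open>i\<close>. Hence the relative deviation of \<open>W\<close> from the uniform vector shrinks at each level by the
  probability that some child uses \<open>c'\<close> given that \<open>e\<close> has color \<open>c\<close>. Three levels of unpinned edges
  suffice to bound this probability by \<open>2\<Delta> / (2\<Delta> + 1)\<close> when \<open>q \<ge> 2\<Delta> - 1\<close>, which beats the required
  rate.

  Upper bound on \<open>q\<close>. If \<open>\<Delta> \<le> q \<le> 2\<Delta> - 2\<close>, fix a set \<open>A\<close> of \<open>\<Delta> - 1\<close> colors and take a tree whose branching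
  alternates between \<open>|A|\<close> and \<open>q - |A|\<close>. Pinning each lowest group of siblings to all of \<open>A\<close> forces the
  next level into the complement, which is then exhausted by each group of siblings, and so on up
  to the root. Two choices of \<open>A\<close> with disjoint complements give total variation distance \<open>1\<close> at any
  depth. If \<open>q < \<Delta>\<close>, there is no proper coloring at all.
\<close>

section \<open>Weighted sums over injections\<close>

definition inj_maps :: "nat \<Rightarrow> 'i set \<Rightarrow> nat set \<Rightarrow> ('i \<Rightarrow> nat) set" where
  "inj_maps q I S = {g \<in> I \<rightarrow>\<^sub>E {1..q} - S. inj_on g I}"

text \<open>The partition function of a clique of sibling edges: they take distinct colors outside
  \<open>S\<close>, and \<open>w i c\<close> stands for the number of ways to complete branch
  \<open>i\<close> once its root edge has color \<open>c\<close>.\<close>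

definition inj_sum :: "nat \<Rightarrow> 'i set \<Rightarrow> ('i \<Rightarrow> nat \<Rightarrow> real) \<Rightarrow> nat set \<Rightarrow> real" where
  "inj_sum q I w S = (\<Sum>g\<in>inj_maps q I S. \<Prod>i\<in>I. w i (g i))"

lemma finite_inj_maps: "finite I \<Longrightarrow> finite (inj_maps q I S)"
  unfolding inj_maps_def by (intro finite_subset[OF _ finite_PiE[of I "\<lambda>_. {1..q} - S"]]) auto

lemma inj_sum_nonneg: "(\<And>i c. i \<in> I \<Longrightarrow> 0 \<le> w i c) \<Longrightarrow> 0 \<le> inj_sum q I w S"
  unfolding inj_sum_def by (intro sum_nonneg prod_nonneg) auto

lemma inj_sum_empty: "inj_sum q {} w S = 1"
  by (simp add: inj_sum_def inj_maps_def)

text \<open>Expansion along one index, as for a permanent: an injection on \<open>insert i I\<close>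
  amounts to a color \<open>b\<close> for \<open>i\<close> and an injection on \<open>I\<close> that
  also avoids \<open>b\<close>.\<close>

lemma inj_sum_insert:
  assumes "finite I" "i \<notin> I"
  shows "inj_sum q (insert i I) w S = (\<Sum>b\<in>{1..q} - S. w i b * inj_sum q I w (insert b S))"
proof -
  let ?P = "Sigma ({1..q} - S) (\<lambda>b. inj_maps q I (insert b S))"
  let ?h = "\<lambda>(b, g). g(i := b)"
  have inj: "inj_on ?h ?P"
  proof (rule inj_onI, clarify)
    fix b g b' g'
    assume g: "g \<in> inj_maps q I (insert b S)" and g': "g' \<in> inj_maps q I (insert b' S)"
      and eq: "g(i := b) = g'(i := b')"
    have "b = b'" using fun_cong[OF eq, of i] by simp
    moreover have "g = g'"
    proof (rule ext)
      fix x show "g x = g' x"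
        using fun_cong[OF eq, of x] g g' assms(2)
        by (cases "x = i") (auto simp: inj_maps_def PiE_iff extensional_def)
    qed
    ultimately show "b = b' \<and> g = g'" by simp
  qed
  have img: "?h ` ?P = inj_maps q (insert i I) S"
  proof (intro equalityI subsetI)
    fix k assume "k \<in> ?h ` ?P"
    then show "k \<in> inj_maps q (insert i I) S"
      using assms(2) by (auto simp: inj_maps_def PiE_iff extensional_def inj_on_def split: if_splits)
  next
    fix k assume k: "k \<in> inj_maps q (insert i I) S"
    have "(k i, k(i := undefined)) \<in> ?P"
      using k assms(2) by (auto simp: inj_maps_def PiE_iff extensional_def inj_on_def)
    moreover have "k = ?h (k i, k(i := undefined))" by simp
    ultimately show "k \<in> ?h ` ?P" by (metis imageI)
  qed
  have "inj_sum q (insert i I) w S = (\<Sum>k\<in>?h ` ?P. \<Prod>j\<in>insert i I. w j (k j))"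
    unfolding img inj_sum_def ..
  also have "\<dots> = (\<Sum>x\<in>?P. w i (fst x) * (\<Prod>j\<in>I. w j (snd x j)))"
  proof (subst sum.reindex[OF inj], rule sum.cong[OF refl])
    fix x assume "x \<in> ?P"
    have "(\<Prod>j\<in>I. w j (?h x j)) = (\<Prod>j\<in>I. w j (snd x j))"
      using assms(2) by (intro prod.cong) (auto split: prod.splits)
    then show "((\<lambda>k. \<Prod>j\<in>insert i I. w j (k j)) \<circ> ?h) x = w i (fst x) * (\<Prod>j\<in>I. w j (snd x j))"
      using assms by (auto split: prod.splits)
  qed
  also have "\<dots> = (\<Sum>b\<in>{1..q} - S. \<Sum>g\<in>inj_maps q I (insert b S). w i b * (\<Prod>j\<in>I. w j (g j)))"
    by (subst sum.Sigma) (simp_all add: finite_inj_maps assms case_prod_beta)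
  finally show ?thesis by (simp add: inj_sum_def sum_distrib_left)
qed

lemma inj_sum_remove:
  assumes "finite I" "i \<in> I"
  shows "inj_sum q I w S = (\<Sum>b\<in>{1..q} - S. w i b * inj_sum q (I - {i}) w (insert b S))"
  using inj_sum_insert[of "I - {i}" i q w S] assms by (simp only: finite_Diff insert_Diff) blast

text \<open>By injectivity, a map either misses \<open>c\<close> or takes it at exactly one
  index.\<close>

lemma inj_sum_forbid:
  assumes "finite I" "c \<in> {1..q} - S"
  shows "inj_sum q I w S =
    inj_sum q I w (insert c S) + (\<Sum>i\<in>I. w i c * inj_sum q (I - {i}) w (insert c S))"
  using assms
proof (induction I arbitrary: S rule: finite_induct)
  case empty
  then show ?case by (simp add: inj_sum_empty)
next
  case (insert i I)
  have IH: "inj_sum q I w (insert b S) = inj_sum q I w (insert b (insert c S)) +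
      (\<Sum>j\<in>I. w j c * inj_sum q (I - {j}) w (insert b (insert c S)))"
    if "b \<in> {1..q} - insert c S" for b
    using insert.IH[of "insert b S"] that insert.prems by (auto simp: insert_commute)
  \<comment> \<open>The new index \<open>i\<close> takes either \<open>c\<close> itself or another
    color \<open>b\<close>; in the second case \<open>IH\<close> decides whether some old index
    takes \<open>c\<close>.\<close>
  have split: "{1..q} - S = insert c ({1..q} - insert c S)" using insert.prems by auto
  have rem: "inj_sum q (insert i I - {j}) w (insert c S)
      = (\<Sum>b\<in>{1..q} - insert c S. w i b * inj_sum q (I - {j}) w (insert b (insert c S)))" if "j \<in> I" for j
  proof -
    have "insert i I - {j} = insert i (I - {j})" using that insert.hyps by auto
    then show ?thesis using insert.hyps by (simp add: inj_sum_insert)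
  qed
  have "inj_sum q (insert i I) w S = w i c * inj_sum q I w (insert c S) +
      (\<Sum>b\<in>{1..q} - insert c S. w i b * inj_sum q I w (insert b S))"
    unfolding inj_sum_insert[OF insert.hyps] by (subst split, subst sum.insert) simp_all
  also have "(\<Sum>b\<in>{1..q} - insert c S. w i b * inj_sum q I w (insert b S)) =
     (\<Sum>b\<in>{1..q} - insert c S. w i b * inj_sum q I w (insert b (insert c S))) +
     (\<Sum>b\<in>{1..q} - insert c S. \<Sum>j\<in>I. w j c * (w i b * inj_sum q (I - {j}) w (insert b (insert c S))))"
    by (subst sum.distrib[symmetric], rule sum.cong[OF refl], subst IH)
      (auto simp: algebra_simps sum_distrib_left)
  also have "(\<Sum>b\<in>{1..q} - insert c S. w i b * inj_sum q I w (insert b (insert c S)))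
      = inj_sum q (insert i I) w (insert c S)"
    using insert.hyps by (simp add: inj_sum_insert)
  also have "(\<Sum>b\<in>{1..q} - insert c S. \<Sum>j\<in>I. w j c * (w i b * inj_sum q (I - {j}) w (insert b (insert c S))))
      = (\<Sum>j\<in>I. w j c * inj_sum q (insert i I - {j}) w (insert c S))"
    by (subst sum.swap) (simp add: rem sum_distrib_left)
  finally show ?case using insert.hyps by simp
qed

section \<open>Comparison inequalities for nonnegative weights\<close>

context
  fixes q :: nat and I :: "'i set" and w :: "'i \<Rightarrow> nat \<Rightarrow> real"
  assumes finI: "finite I" and w_nonneg: "\<And>i c. i \<in> I \<Longrightarrow> 0 \<le> w i c"
begin

text \<open>The form \<open>I - J\<close> covers both the full index set and the one with a branch
  removed, under a single hypothesis on \<open>I\<close>.\<close>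

lemma inj_sum_minus_nonneg: "0 \<le> inj_sum q (I - J) w S"
  by (rule inj_sum_nonneg) (use w_nonneg in auto)

lemma inj_sum_antimono:
  assumes "S \<subseteq> S'"
  shows "inj_sum q (I - J) w S' \<le> inj_sum q (I - J) w S"
  unfolding inj_sum_def
proof (rule sum_mono2)
  show "finite (inj_maps q (I - J) S)" using finI by (simp add: finite_inj_maps)
  show "inj_maps q (I - J) S' \<subseteq> inj_maps q (I - J) S"
    using assms unfolding inj_maps_def by (auto simp: PiE_iff)
  show "0 \<le> (\<Prod>i\<in>I - J. w i (g i))" for g
    by (intro prod_nonneg) (use w_nonneg in auto)
qed

text \<open>Two constraints are relaxed: the other values need no longer avoid the value at
  \<open>i\<close>, and the value at \<open>i\<close> need no longer avoid \<open>S\<close>.\<close>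

lemma inj_sum_upper:
  assumes "i \<in> I"
  shows "inj_sum q I w S \<le> (\<Sum>b\<in>{1..q}. w i b) * inj_sum q (I - {i}) w S"
proof -
  have "inj_sum q I w S = (\<Sum>b\<in>{1..q} - S. w i b * inj_sum q (I - {i}) w (insert b S))"
    by (rule inj_sum_remove[OF finI assms(1)])
  also have "\<dots> \<le> (\<Sum>b\<in>{1..q} - S. w i b * inj_sum q (I - {i}) w S)"
    by (intro sum_mono mult_left_mono inj_sum_antimono) (use w_nonneg assms in auto)
  also have "\<dots> \<le> (\<Sum>b\<in>{1..q}. w i b * inj_sum q (I - {i}) w S)"
    by (intro sum_mono2) (use w_nonneg assms inj_sum_minus_nonneg in auto)
  finally show ?thesis by (simp add: sum_distrib_right)
qed

text \<open>A union bound. Once the other indices are colored, \<open>i\<close> has to avoid at most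
  \<open>card S + card I - 1\<close> colors, each carrying at most the fraction \<open>u\<close> of
  the total weight of \<open>w i\<close>.\<close>

lemma inj_sum_lower:
  assumes "i \<in> I" "finite S" "0 \<le> u"
    and u: "\<And>b. b \<in> {1..q} \<Longrightarrow> w i b \<le> u * (\<Sum>b\<in>{1..q}. w i b)"
  shows "(1 - real (card S + card I - 1) * u) * (\<Sum>b\<in>{1..q}. w i b) * inj_sum q (I - {i}) w S
    \<le> inj_sum q I w S"
proof -
  let ?T = "\<Sum>b\<in>{1..q}. w i b" and ?J = "I - {i}"
  let ?Z = "inj_sum q ?J w S"
  have T: "0 \<le> ?T" by (intro sum_nonneg) (use w_nonneg assms in auto)
  have Z: "0 \<le> ?Z" by (rule inj_sum_minus_nonneg)
  have cardI: "card I = Suc (card ?J)" using finI assms(1) by (metis card.remove)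
  \<comment> \<open>Subtracts from \<open>?Z\<close> the maps in which another index
    \<open>j\<close> already takes \<open>b\<close>.\<close>
  have eq: "inj_sum q ?J w (insert b S) =
      ?Z - (\<Sum>j\<in>?J. w j b * inj_sum q (?J - {j}) w (insert b S))" if "b \<in> {1..q} - S" for b
    using inj_sum_forbid[of ?J b q S w] finI that by simp
  have "(1 - real (card S)*u) * ?T \<le> ?T - (\<Sum>b\<in>{1..q} \<inter> S. w i b)"
  proof -
    have "(\<Sum>b\<in>{1..q} \<inter> S. w i b) \<le> real (card ({1..q} \<inter> S)) * (u * ?T)"
      by (intro sum_bounded_above) (use u in auto)
    also have "\<dots> \<le> real (card S) * (u * ?T)"
      by (intro mult_right_mono) (use assms T in \<open>auto intro: card_mono\<close>)
    finally show ?thesis by (simp add: algebra_simps)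
  qed
  also have "?T - (\<Sum>b\<in>{1..q} \<inter> S. w i b) = (\<Sum>b\<in>{1..q} - S. w i b)"
    using sum.Int_Diff[of "{1..q}" "w i" S] by simp
  finally have 1: "(1 - real (card S)*u) * ?T \<le> (\<Sum>b\<in>{1..q} - S. w i b)" .
  have "(\<Sum>b\<in>{1..q} - S. w i b * (\<Sum>j\<in>?J. w j b * inj_sum q (?J - {j}) w (insert b S)))
      \<le> (\<Sum>b\<in>{1..q} - S. (u * ?T) * (\<Sum>j\<in>?J. w j b * inj_sum q (?J - {j}) w (insert b S)))"
    by (intro sum_mono mult_right_mono sum_nonneg mult_nonneg_nonneg inj_sum_nonneg u)
      (use w_nonneg in auto)
  \<comment> \<open>Summing over \<open>b\<close> first reassembles \<open>inj_sum q ?J w S\<close>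
    by expansion along \<open>j\<close>, so each other index contributes one copy of
    \<open>?Z\<close>.\<close>
  also have "\<dots> = (u * ?T) * (\<Sum>j\<in>?J. inj_sum q ?J w S)"
    by (subst sum_distrib_left[symmetric], subst sum.swap, subst (2) sum.cong[OF refl])
      (auto simp: inj_sum_remove[of ?J] finI)
  finally have 2: "(\<Sum>b\<in>{1..q} - S. w i b * (\<Sum>j\<in>?J. w j b * inj_sum q (?J - {j}) w (insert b S)))
      \<le> u * ?T * (real (card ?J) * ?Z)" by simp
  have "inj_sum q I w S = (\<Sum>b\<in>{1..q} - S. w i b * inj_sum q ?J w (insert b S))"
    by (rule inj_sum_remove[OF finI assms(1)])
  also have "\<dots> = (\<Sum>b\<in>{1..q} - S. w i b) * ?Z -
      (\<Sum>b\<in>{1..q} - S. w i b * (\<Sum>j\<in>?J. w j b * inj_sum q (?J - {j}) w (insert b S)))"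
    by (simp add: eq sum_distrib_right sum_subtractf right_diff_distrib)
  also have "(1 - real (card S)*u) * ?T * ?Z - u * ?T * (real (card ?J) * ?Z) \<le> \<dots>"
    by (intro diff_mono mult_right_mono 1 2 Z)
  finally show ?thesis by (simp add: cardI algebra_simps)
qed

text \<open>Double counting: every injection on \<open>I\<close> misses exactly
  \<open>q - card I\<close> colors.\<close>

lemma sum_inj_sum_singleton:
  assumes "card I \<le> q"
  shows "(\<Sum>c\<in>{1..q}. inj_sum q I w {c}) = (real q - real (card I)) * inj_sum q I w {}"
proof -
  have "inj_sum q I w {c} = inj_sum q I w {} - (\<Sum>i\<in>I. w i c * inj_sum q (I - {i}) w {c})"
    if "c \<in> {1..q}" for c
    using inj_sum_forbid[of I c q "{}" w] finI that by simp
  then have "(\<Sum>c\<in>{1..q}. inj_sum q I w {c}) = real q * inj_sum q I w {} -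
      (\<Sum>c\<in>{1..q}. \<Sum>i\<in>I. w i c * inj_sum q (I - {i}) w {c})"
    by (simp add: sum_subtractf)
  also have "(\<Sum>c\<in>{1..q}. \<Sum>i\<in>I. w i c * inj_sum q (I - {i}) w {c}) = (\<Sum>i\<in>I. inj_sum q I w {})"
    by (subst sum.swap, rule sum.cong[OF refl], subst inj_sum_remove[of I]) (auto simp: finI)
  finally show ?thesis by (simp add: algebra_simps)
qed

end

section \<open>Contraction of branch weights\<close>

text \<open>The weights that a branch assigns to the colors of its root edge when its first \<open>n\<close> levels are
  unpinned. The upper, lower and improved upper bounds on the normalized weights bootstrap each
  other, one level at a time; from the fourth level on the deviation contracts.\<close>

definition mixing_weight :: "nat \<Rightarrow> nat \<Rightarrow> nat \<Rightarrow> (nat \<Rightarrow> real) \<Rightarrow> bool" where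
  "mixing_weight \<Delta> q n W \<longleftrightarrow>
     (\<forall>c. 0 \<le> W c) \<and>
     (n \<ge> 1 \<longrightarrow> (\<forall>c\<in>{1..q}. real \<Delta> * W c \<le> sum W {1..q})) \<and>
     (n \<ge> 2 \<longrightarrow> (\<forall>c\<in>{1..q}. sum W {1..q} \<le> real \<Delta> * real q * W c)) \<and>
     (n \<ge> 3 \<longrightarrow> (\<forall>c\<in>{1..q}. (real \<Delta> + (real \<Delta> - 1) / (2 * real \<Delta>)) * W c \<le> sum W {1..q})) \<and>
     (\<forall>c\<in>{1..q}. \<forall>c'\<in>{1..q}.
        \<bar>W c - W c'\<bar> \<le> (2 * real \<Delta> / (2 * real \<Delta> + 1)) ^ (n - 3) * (W c + W c'))"

lemma mixing_weight_cong:
  assumes "\<And>c. c \<in> {1..q} \<Longrightarrow> W c = W' c" "\<And>c. 0 \<le> W' c" "mixing_weight \<Delta> q n W"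
  shows "mixing_weight \<Delta> q n W'"
proof -
  have "sum W {1..q} = sum W' {1..q}" using assms(1) by (intro sum.cong) auto
  then show ?thesis using assms unfolding mixing_weight_def by simp
qed

text \<open>Truncated subtraction makes the exponent \<open>0 - 3\<close> equal to 0, so the
  deviation clause is the trivial bound for nonnegative numbers.\<close>

lemma mixing_weight_0: "(\<And>c. 0 \<le> W c) \<Longrightarrow> mixing_weight \<Delta> q 0 W"
  unfolding mixing_weight_def by (auto simp: abs_le_iff intro: add_increasing2)

text \<open>Each clause for \<open>Suc n\<close> rests on an earlier clause at the children: the
  upper bound on counting alone, the lower bound on the upper one, the improved upper bound on the
  lower one, and the contraction on the improved bound. The parent edge occupies one of the \<Delta>
  places at its lower endpoint, whence \<open>card I + 1\<close>.\<close>

lemma mixing_weight_step: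
  assumes \<Delta>: "\<Delta> \<ge> 2" and q: "q \<ge> 2 * \<Delta> - 1" and finI: "finite I" and cardI: "card I + 1 \<le> \<Delta>"
    and w: "\<And>i. i \<in> I \<Longrightarrow> mixing_weight \<Delta> q n (w i)"
  shows "mixing_weight \<Delta> q (Suc n) (\<lambda>c. inj_sum q I w {c})"
proof -
  let ?W = "\<lambda>c. inj_sum q I w {c}"
  define d where "d = card I"
  define T where "T = sum ?W {1..q}"
  define t where "t = (\<lambda>i. sum (w i) {1..q})"
  let ?Z = "inj_sum q I w {}"
  have nonneg: "0 \<le> w i c" if "i \<in> I" for i c using w[OF that] by (auto simp: mixing_weight_def)
  have Znn: "0 \<le> inj_sum q (I - J) w S" for J S by (rule inj_sum_minus_nonneg[OF finI nonneg])
  have Inn: "0 \<le> inj_sum q I w S" for S using Znn[of "{}"] by simp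
  have tnn: "0 \<le> t i" if "i \<in> I" for i unfolding t_def by (intro sum_nonneg) (use nonneg that in auto)
  have d: "d + 1 \<le> \<Delta>" "real d \<le> real \<Delta> - 1" using cardI by (auto simp: d_def)
  have qr: "real q \<ge> 2 * real \<Delta> - 1" using q \<Delta> by linarith
  have T: "T = (real q - real d) * ?Z"
    unfolding T_def d_def by (rule sum_inj_sum_singleton[OF finI nonneg]) (use q cardI in auto)
  \<comment> \<open>The threshold enters: after at most \<Delta> - 1 siblings have taken their
    colors, at least \<Delta> colors remain.\<close>
  have qd: "real q - real d \<ge> real \<Delta>" using qr d by linarith
  have forbid: "?Z = ?W c + (\<Sum>i\<in>I. w i c * inj_sum q (I - {i}) w {c})" if "c \<in> {1..q}" for c
    using inj_sum_forbid[of I c q "{}" w] finI that by simp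
  have prop1: "real \<Delta> * ?W c \<le> T" if "c \<in> {1..q}" for c
  proof -
    have "?W c \<le> ?Z" using inj_sum_antimono[OF finI nonneg, where S="{}" and S'="{c}" and J="{}" and q=q] by simp
    then have "real \<Delta> * ?W c \<le> (real q - real d) * ?Z"
      using qd Inn[of "{c}"] by (intro mult_mono) auto
    then show ?thesis by (simp add: T)
  qed
  have prop2: "T \<le> real \<Delta> * real q * ?W c" if c: "c \<in> {1..q}" and n: "n \<ge> 1" for c
  proof -
    \<comment> \<open>Branch \<open>i\<close> must avoid \<open>c\<close> and the colors of its
      siblings, at most \<Delta> - 1 colors of fraction at most 1/\<Delta> each. The fraction left
      is at least 1/\<Delta>, hence no less than that of \<open>c\<close>.\<close>
    have "w i c * inj_sum q (I - {i}) w {c} \<le> ?W c" if i: "i \<in> I" for i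
    proof -
      have u: "real \<Delta> * w i b \<le> t i" if "b \<in> {1..q}" for b
        using w[OF i] n that by (auto simp: mixing_weight_def t_def)
      have "(1 - real (card {c} + card I - 1) * (1 / real \<Delta>)) * t i * inj_sum q (I - {i}) w {c} \<le> ?W c"
        unfolding t_def
        by (rule inj_sum_lower[OF finI nonneg i])
          (use u \<Delta> in \<open>auto simp: t_def field_simps\<close>)
      moreover have "w i c \<le> (1 - real (card {c} + card I - 1) * (1 / real \<Delta>)) * t i"
      proof -
        have "w i c \<le> 1 / real \<Delta> * t i" using u[OF c] \<Delta> by (simp add: field_simps)
        also have "\<dots> \<le> (1 - real (card {c} + card I - 1) * (1 / real \<Delta>)) * t i"
          using d \<Delta> tnn[OF i] by (intro mult_right_mono) (auto simp: d_def field_simps)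
        finally show ?thesis .
      qed
      ultimately show ?thesis
        using mult_right_mono[OF _ Znn[of "{i}" "{c}"]] by (meson order_trans)
    qed
    then have "(\<Sum>i\<in>I. w i c * inj_sum q (I - {i}) w {c}) \<le> real d * ?W c"
      unfolding d_def by (intro sum_bounded_above) auto
    then have "?Z \<le> real \<Delta> * ?W c"
      using forbid[OF c] d mult_right_mono[OF d(2) Inn[of "{c}"]] by (simp add: algebra_simps)
    then have "T \<le> real q * (real \<Delta> * ?W c)"
      unfolding T using qd Inn by (intro mult_mono) auto
    then show ?thesis by (simp add: algebra_simps)
  qed
  have prop3: "(real \<Delta> + (real \<Delta> - 1) / (2 * real \<Delta>)) * ?W c \<le> T"
    if c: "c \<in> {1..q}" and n: "n \<ge> 2" for c
  proof -
    have q0: "real q > 0" using c by auto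
    \<comment> \<open>Color \<open>c\<close> carries at least the fraction 1/(\<Delta> q) of branch
      \<open>i\<close>, so allowing it there adds at least this fraction of \<open>?W c\<close> to
      \<open>?Z\<close>.\<close>
    have "?W c / (real \<Delta> * real q) \<le> w i c * inj_sum q (I - {i}) w {c}" if i: "i \<in> I" for i
    proof -
      have l: "t i \<le> real \<Delta> * real q * w i c"
        using w[OF i] n c unfolding mixing_weight_def t_def by auto
      have "?W c \<le> t i * inj_sum q (I - {i}) w {c}"
        unfolding t_def by (rule inj_sum_upper[OF finI nonneg i])
      also have "\<dots> \<le> real \<Delta> * real q * w i c * inj_sum q (I - {i}) w {c}"
        by (intro mult_right_mono l Znn)
      finally show ?thesis using q0 \<Delta> by (simp add: field_simps)
    qed
    then have "real d * (?W c / (real \<Delta> * real q)) \<le> (\<Sum>i\<in>I. w i c * inj_sum q (I - {i}) w {c})"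
      unfolding d_def by (intro sum_bounded_below) auto
    then have Z: "(1 + real d / (real \<Delta> * real q)) * ?W c \<le> ?Z"
      using forbid[OF c] by (simp add: algebra_simps)
    \<comment> \<open>With \<open>d / q\<close> at most 1/2, the factor in front of
      \<open>?W c\<close> is at least 2\<Delta> - 1 - d (1 - 1/(2\<Delta>)). This decreases in
      \<open>d\<close>, and the extreme case d = \<Delta> - 1 gives the constant of the improved
      bound.\<close>
    have "real d / real q \<le> 1 / 2" using q0 qr d by (simp add: field_simps)
    then have "real d / real \<Delta> * (1 / 2) \<le> real d / real \<Delta> * (1 - real d / real q)"
      by (intro mult_left_mono) auto
    moreover have "(real \<Delta> - 1) * (1 - 1 / (2 * real \<Delta>)) \<ge> real d * (1 - 1 / (2 * real \<Delta>))"
      using d \<Delta> by (intro mult_right_mono) (auto simp: field_simps)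
    moreover have "(real \<Delta> - 1) * (1 - 1 / (2 * real \<Delta>)) = real \<Delta> - 1 - (real \<Delta> - 1) / (2 * real \<Delta>)"
      "real d * (1 - 1 / (2 * real \<Delta>)) = real d - real d / real \<Delta> * (1 / 2)"
      by (simp_all add: algebra_simps diff_divide_distrib)
    ultimately have "real \<Delta> + (real \<Delta> - 1) / (2 * real \<Delta>) \<le>
        real q - real d + real d / real \<Delta> * (1 - real d / real q)"
      using qr by linarith
    also have "\<dots> = (real q - real d) * (1 + real d / (real \<Delta> * real q))"
      using q0 \<Delta> by (simp add: field_simps)
    finally have "(real \<Delta> + (real \<Delta> - 1) / (2 * real \<Delta>)) * ?W c \<le>
        (real q - real d) * ((1 + real d / (real \<Delta> * real q)) * ?W c)"
      unfolding mult.assoc[symmetric] by (intro mult_right_mono Inn)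
    also have "\<dots> \<le> T" unfolding T using qd by (intro mult_left_mono Z) auto
    finally show ?thesis .
  qed
  define \<rho> where "\<rho> = 2 * real \<Delta> / (2 * real \<Delta> + 1)"
  have \<rho>: "0 \<le> \<rho>" by (simp add: \<rho>_def)
  have prop4: "\<bar>?W c - ?W c'\<bar> \<le> \<rho> ^ (Suc n - 3) * (?W c + ?W c')"
    if c: "c \<in> {1..q}" "c' \<in> {1..q}" for c c'
  \<comment> \<open>For \<open>n \<le> 2\<close> the exponent is still 0 and nothing has to
    contract.\<close>
  proof (cases "n \<ge> 3 \<and> c \<noteq> c'")
    case False
    then consider "Suc n - 3 = 0" | "c = c'" by force
    then show ?thesis using Inn[of "{c}"] Inn[of "{c'}"] \<rho>
      by cases (auto simp: abs_le_iff)
  next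
    case True
    let ?U = "\<lambda>i. inj_sum q (I - {i}) w {c, c'}" and ?Y = "inj_sum q I w {c, c'}"
    \<comment> \<open>When both \<open>c\<close> and \<open>c'\<close> are barred from the siblings
      except that one of them may take \<open>b\<close>, the share in which some child does take
      \<open>b\<close> is at most \<rho>.\<close>
    have used: "(\<Sum>i\<in>I. w i b * ?U i) \<le> \<rho> * (?Y + (\<Sum>i\<in>I. w i b * ?U i))" if b: "b \<in> {1..q}" for b
    proof -
      define v where "v = real \<Delta> + (real \<Delta> - 1) / (2 * real \<Delta>)"
      have v: "v > 0" using \<Delta> unfolding v_def by (intro add_pos_nonneg) auto
      \<comment> \<open>At most \<Delta> colors are barred at branch \<open>i\<close>, each of
        fraction at most \<open>1 / v\<close>. Since v - \<Delta> = (\<Delta> - 1)/(2\<Delta>) is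
        positive, a definite fraction remains.\<close>
      have "(real \<Delta> - 1) * (w i b * ?U i) \<le> 2 * real \<Delta> * ?Y" if i: "i \<in> I" for i
      proof -
        have u: "v * w i b \<le> t i" if "b \<in> {1..q}" for b
          using w[OF i] True that unfolding mixing_weight_def t_def v_def by blast
        have "(1 - real (card {c, c'} + card I - 1) * (1 / v)) * t i * ?U i \<le> ?Y"
          unfolding t_def
          by (rule inj_sum_lower[OF finI nonneg i])
            (use u v in \<open>auto simp: t_def pos_le_divide_eq mult.commute\<close>)
        moreover have "(1 - real \<Delta> * (1 / v)) * (t i * ?U i) \<le>
            (1 - real (card {c, c'} + card I - 1) * (1 / v)) * (t i * ?U i)"
          using d True v tnn[OF i] Znn by (intro mult_right_mono diff_left_mono) (auto simp: d_def)
        ultimately have "(1 - real \<Delta> * (1 / v)) * (t i * ?U i) \<le> ?Y" by (simp add: mult.assoc)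
        then have "v * ((1 - real \<Delta> * (1 / v)) * (t i * ?U i)) \<le> v * ?Y"
          using v by (intro mult_left_mono) auto
        also have "v * ((1 - real \<Delta> * (1 / v)) * (t i * ?U i)) = (v - real \<Delta>) * (t i * ?U i)"
          using v by (simp add: field_simps)
        finally have "(real \<Delta> - 1) * (t i * ?U i) \<le> 2 * real \<Delta> * (v * ?Y)"
          using \<Delta> by (simp add: v_def[THEN arg_cong[where f="\<lambda>x. x - real \<Delta>"]] field_simps)
        moreover have "(real \<Delta> - 1) * ((v * w i b) * ?U i) \<le> (real \<Delta> - 1) * (t i * ?U i)"
          by (intro mult_left_mono mult_right_mono u b Znn) (use \<Delta> in auto)
        ultimately have "v * ((real \<Delta> - 1) * (w i b * ?U i)) \<le> v * (2 * real \<Delta> * ?Y)"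
          by (simp add: mult_ac)
        then show ?thesis using v by (simp only: mult_le_cancel_left_pos)
      qed
      \<comment> \<open>The number of children, at most \<Delta> - 1, cancels the factor \<Delta> -
        1 and leaves 2\<Delta> times \<open>?Y\<close>; this ratio is the source of \<rho>.\<close>
      then have "(\<Sum>i\<in>I. (real \<Delta> - 1) * (w i b * ?U i)) \<le> real d * (2 * real \<Delta> * ?Y)"
        unfolding d_def by (intro sum_bounded_above) auto
      also have "\<dots> \<le> (real \<Delta> - 1) * (2 * real \<Delta> * ?Y)"
        by (intro mult_right_mono d) (use Inn in auto)
      finally have "(\<Sum>i\<in>I. w i b * ?U i) \<le> 2 * real \<Delta> * ?Y"
        using \<Delta> by (simp add: sum_distrib_left[symmetric])
      then show ?thesis by (simp add: \<rho>_def field_simps)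
    qed
    have c1: "?W c = ?Y + (\<Sum>i\<in>I. w i c' * ?U i)"
      using inj_sum_forbid[of I c' q "{c}" w] finI c True by (simp add: insert_commute)
    have c2: "?W c' = ?Y + (\<Sum>i\<in>I. w i c * ?U i)"
      using inj_sum_forbid[of I c q "{c'}" w] finI c True by simp
    have "\<bar>?W c - ?W c'\<bar> = \<bar>\<Sum>i\<in>I. (w i c' - w i c) * ?U i\<bar>"
      by (simp add: c1 c2 sum_subtractf left_diff_distrib)
    also have "\<dots> \<le> (\<Sum>i\<in>I. \<bar>w i c' - w i c\<bar> * ?U i)"
      by (rule order_trans[OF sum_abs]) (simp add: abs_mult Znn)
    also have "\<dots> \<le> (\<Sum>i\<in>I. (\<rho> ^ (n - 3) * (w i c' + w i c)) * ?U i)"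
      by (intro sum_mono mult_right_mono Znn) (use w c in \<open>auto simp: mixing_weight_def \<rho>_def\<close>)
    also have "\<dots> = \<rho> ^ (n - 3) * ((\<Sum>i\<in>I. w i c' * ?U i) + (\<Sum>i\<in>I. w i c * ?U i))"
      by (simp add: sum_distrib_left sum.distrib algebra_simps)
    \<comment> \<open>The new factor \<rho>: each sum is the part of \<open>?W\<close> in which a
      child takes the other color.\<close>
    also have "\<dots> \<le> \<rho> ^ (n - 3) * (\<rho> * ?W c + \<rho> * ?W c')"
      using used[OF c(1)] used[OF c(2)] \<rho> by (intro mult_left_mono add_mono) (auto simp: c1 c2)
    also have "\<dots> = \<rho> ^ (Suc n - 3) * (?W c + ?W c')"
    proof -
      have "Suc n - 3 = Suc (n - 3)" using True by linarith
      then show ?thesis by (simp only: power_Suc) (simp add: algebra_simps)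
    qed
    finally show ?thesis .
  qed
  show ?thesis
    unfolding mixing_weight_def T_def[symmetric] \<rho>_def[symmetric]
    using Inn prop1 prop2 prop3 prop4 by auto
qed

section \<open>Paths and branches\<close>

lemma path_edges_Nil [simp]: "path_edges [] = {}"
  and path_edges_single [simp]: "path_edges [x] = {}"
  by (auto simp: path_edges_def)

lemma path_edges_Cons2 [simp]: "path_edges (x # y # zs) = insert {x, y} (path_edges (y # zs))"
proof -
  have "{i. Suc i < length (x # y # zs)} = insert 0 (Suc ` {i. Suc i < length (y # zs)})"
    by (auto simp: image_iff) (metis less_Suc_eq_0_disj)
  then have "(\<lambda>i. {(x # y # zs) ! i, (x # y # zs) ! Suc i}) ` {i. Suc i < length (x # y # zs)}
    = insert {x, y} ((\<lambda>i. {(y # zs) ! i, (y # zs) ! Suc i}) ` {i. Suc i < length (y # zs)})"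
    by (simp only: image_insert image_image) simp
  then show ?thesis unfolding path_edges_def by (simp only: setcompr_eq_image)
qed

lemma path_edges_append:
  "xs \<noteq> [] \<Longrightarrow> ys \<noteq> [] \<Longrightarrow>
    path_edges (xs @ ys) = insert {last xs, hd ys} (path_edges xs \<union> path_edges ys)"
proof (induction xs)
  case (Cons x xs)
  then show ?case by (cases xs; cases ys) auto
qed simp

lemma path_edges_rev [simp]: "path_edges (rev xs) = path_edges xs"
proof (induction xs)
  case (Cons x xs)
  then show ?case
    using path_edges_append[of "rev xs" "[x]"] by (cases xs) (simp_all add: insert_commute)
qed simp

lemma path_edges_subset_set: "f \<in> path_edges p \<Longrightarrow> f \<subseteq> set p"
  by (auto simp: path_edges_def)

lemma is_path_append_iff:
  "xs \<noteq> [] \<Longrightarrow> ys \<noteq> [] \<Longrightarrow> is_path V E (xs @ ys) \<longleftrightarrow>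
    is_path V E xs \<and> is_path V E ys \<and> set xs \<inter> set ys = {} \<and> {last xs, hd ys} \<in> E"
  by (auto simp: is_path_def path_edges_append)

lemma is_path_rev [simp]: "is_path V E (rev xs) = is_path V E xs"
  by (simp add: is_path_def)

lemma is_path_Cons2:
  "is_path V E (x # y # zs) \<longleftrightarrow> x \<in> V \<and> x \<notin> set (y # zs) \<and> {x, y} \<in> E \<and> is_path V E (y # zs)"
  by (auto simp: is_path_def)

lemma is_path_prefix: "is_path V E (xs @ ys) \<Longrightarrow> xs \<noteq> [] \<Longrightarrow> is_path V E xs"
  using is_path_append_iff[of xs ys] by (cases "ys = []") auto

lemma is_path_suffix: "is_path V E (xs @ ys) \<Longrightarrow> ys \<noteq> [] \<Longrightarrow> is_path V E ys"
  using is_path_append_iff[of xs ys] by (cases "xs = []") auto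

text \<open>Two paths that leave \<open>v\<close> by different edges and meet again close a cycle:
  follow one to the meeting point and return along the other.\<close>

lemma acyclic_first_step_unique:
  assumes ac: "graph_acyclic V E"
    and p: "is_path V E (v # w # ys)" and p': "is_path V E (v # w' # ys')"
    and z: "z \<in> set (w # ys)" "z \<in> set (w' # ys')"
  shows "w = w'"
proof (rule ccontr)
  assume neq: "w \<noteq> w'"
  \<comment> \<open>Choosing \<open>x\<close> as the first vertex of one path that lies on the other
    keeps the two arcs of the cycle disjoint.\<close>
  obtain P x R where P: "w # ys = P @ x # R" "x \<in> set (w' # ys')" "\<forall>y\<in>set P. y \<notin> set (w' # ys')"
    using split_list_first_prop[of "w # ys" "\<lambda>y. y \<in> set (w' # ys')"] z by auto
  obtain Q R' where Q: "w' # ys' = Q @ x # R'"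
    using P(2) by (meson split_list)
  have hdP: "hd (P @ [x]) = w" using P(1) by (cases P) auto
  have p1: "is_path V E ((v # P @ [x]) @ R)" using p P(1) by simp
  have p2: "is_path V E ((v # Q @ [x]) @ R')" using p' Q by simp
  have path1: "is_path V E (v # P @ [x])" using is_path_prefix[OF p1] by simp
  have path2: "is_path V E (v # Q @ [x])" using is_path_prefix[OF p2] by simp
  have a: "is_path V E (rev (P @ [x]))"
    using is_path_suffix[of V E "[v]" "P @ [x]"] path1 by (simp del: rev_append)
  have b: "is_path V E (v # Q)" "{last (v # Q), x} \<in> E" "x \<notin> set (v # Q)"
    using path2 is_path_append_iff[of "v # Q" "[x]" V E] by auto
  have disj: "set (v # Q) \<inter> set (rev (P @ [x])) = {}"
    using P(3) Q b(3) path1 by (auto simp: is_path_def)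
  have cyc: "is_path V E ((v # Q) @ rev (P @ [x]))"
    using a b disj by (subst is_path_append_iff) auto
  \<comment> \<open>If both arcs had no inner vertex, \<open>x\<close> would equal both
    \<open>w\<close> and \<open>w'\<close>.\<close>
  have len: "length ((v # Q) @ rev (P @ [x])) \<ge> 3"
  proof (cases "Q = [] \<and> P = []")
    case True
    then show ?thesis using P(1) Q neq by auto
  next
    case False
    then show ?thesis by (cases Q; cases P) auto
  qed
  have "last ((v # Q) @ rev (P @ [x])) = w" using hdP by (simp add: last_rev del: rev_append)
  moreover have "{w, v} \<in> E" using p by (simp add: is_path_Cons2 insert_commute)
  ultimately show False using ac cyc len unfolding graph_acyclic_def by fastforce
qed

text \<open>The one-edge path from \<open>v\<close> to \<open>u\<close> starts differently, so it
  cannot meet the given path again. This permits prepending \<open>u\<close> to the path.\<close>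

lemma acyclic_no_return:
  assumes ac: "graph_acyclic V E" and p: "is_path V E (v # w # ys)" and e: "{u, v} \<in> E"
    and "u \<noteq> w"
  shows "u \<notin> set (w # ys)"
proof
  assume u: "u \<in> set (w # ys)"
  then have "u \<noteq> v" "u \<in> V" "v \<in> V" using p by (auto simp: is_path_def)
  then have "is_path V E [v, u]" using e by (auto simp: is_path_def insert_commute)
  then show False using acyclic_first_step_unique[OF ac p _ u] assms(4) by auto
qed

text \<open>Unless \<open>y\<close> is the next-to-last vertex, the edge closes the tail of the path
  from \<open>y\<close> into a cycle.\<close>

lemma acyclic_edge_at_path_end:
  assumes ac: "graph_acyclic V E" and p: "is_path V E p" and e: "{last p, y} \<in> E"
    and "last p \<noteq> y" "y \<in> set p"
  shows "{last p, y} \<in> path_edges p"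
proof -
  obtain R S where RS: "p = R @ y # S" using assms(5) by (meson split_list)
  have "S \<noteq> []" using RS assms(4) by auto
  then obtain s S' where S: "S = s # S'" by (cases S) auto
  have q: "is_path V E (y # s # S')" using p is_path_suffix[of V E R "y # S"] by (simp add: RS S)
  have "S' = []"
  proof (rule ccontr)
    assume "S' \<noteq> []"
    then have "length (y # s # S') \<ge> 3" by (cases S') auto
    then show False using ac q e unfolding graph_acyclic_def RS S by fastforce
  qed
  then show ?thesis using path_edges_append[of R "y # S"]
    by (cases "R = []") (auto simp: RS S insert_commute)
qed

text \<open>In a tree with edge \<open>{v, w}\<close>: this edge together with the part of the tree
  that it separates from \<open>v\<close>.\<close>

definition branch :: "'v set \<Rightarrow> 'v set set \<Rightarrow> 'v \<Rightarrow> 'v \<Rightarrow> 'v set set" where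
  "branch V E v w = \<Union>{path_edges (v # w # ys) | ys. is_path V E (v # w # ys)}"

lemma branch_subset: "branch V E v w \<subseteq> E"
  by (auto simp: branch_def is_path_def)

section \<open>Branches at a vertex of a tree\<close>

locale tree =
  fixes V :: "'v set" and E :: "'v set set"
  assumes tree: "is_tree V E"
begin

lemma acyclic: "graph_acyclic V E" and connected: "graph_connected V E"
  and finite_V: "finite V" and edge_card: "e \<in> E \<Longrightarrow> card e = 2" and edge_subset: "e \<in> E \<Longrightarrow> e \<subseteq> V"
  using tree by (auto simp: is_tree_def simple_graph_def)

lemma finite_E: "finite E"
  by (rule finite_subset[of _ "Pow V"]) (use finite_V edge_subset in auto)

lemma edge_neq: "{u, v} \<in> E \<Longrightarrow> u \<noteq> v"
  using edge_card[of "{u, v}"] by auto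

lemma edge_in_branch: "{v, w} \<in> E \<Longrightarrow> {v, w} \<in> branch V E v w"
proof -
  assume e: "{v, w} \<in> E"
  then have "is_path V E (v # w # [])"
    using edge_subset[OF e] edge_neq[OF e] by (auto simp: is_path_def)
  moreover have "{v, w} \<in> path_edges (v # w # [])" by simp
  ultimately show ?thesis unfolding branch_def by blast
qed

definition nbrs :: "'v \<Rightarrow> 'v set" where
  "nbrs v = {w. {v, w} \<in> E}"

lemma finite_nbrs: "finite (nbrs v)"
proof -
  have "nbrs v \<subseteq> V" using edge_subset by (auto simp: nbrs_def)
  then show "finite (nbrs v)" using finite_V finite_subset by blast
qed

lemma card_nbrs_le: "v \<in> V \<Longrightarrow> card (nbrs v) \<le> max_degree V E"
proof -
  assume v: "v \<in> V"
  have "card (nbrs v) \<le> card {e \<in> E. v \<in> e}"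
    by (rule card_inj_on_le[of "\<lambda>w. {v, w}"])
      (auto simp: inj_on_def nbrs_def doubleton_eq_iff finite_E)
  also have "\<dots> \<le> max_degree V E"
    using v finite_V by (auto simp: max_degree_def vertex_degree_def intro!: Max_ge)
  finally show ?thesis .
qed

lemma branch_memE:
  assumes "f \<in> branch V E v w"
  obtains ys where "is_path V E (v # w # ys)" "f \<in> path_edges (v # w # ys)"
  using assms by (auto simp: branch_def)

text \<open>The paths that make up the branch start at \<open>v\<close> and never revisit
  it.\<close>

lemma branch_root:
  assumes "f \<in> branch V E v w" "v \<in> f"
  shows "f = {v, w}"
  using assms(1)
proof (rule branch_memE)
  fix ys assume "is_path V E (v # w # ys)" "f \<in> path_edges (v # w # ys)"
  then show ?thesis using assms(2) path_edges_subset_set[of f "w # ys"]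
    by (auto simp: is_path_Cons2)
qed

text \<open>A common vertex other than \<open>v\<close> would be reached by paths from
  \<open>v\<close> with different first steps.\<close>

lemma branches_share:
  assumes "f \<in> branch V E v w" "f' \<in> branch V E v w'" "w \<noteq> w'" "z \<in> f" "z \<in> f'"
  shows "z = v"
proof (rule ccontr)
  assume "z \<noteq> v"
  obtain ys where 1: "is_path V E (v # w # ys)" "f \<in> path_edges (v # w # ys)"
    using assms(1) by (rule branch_memE)
  obtain ys' where 2: "is_path V E (v # w' # ys')" "f' \<in> path_edges (v # w' # ys')"
    using assms(2) by (rule branch_memE)
  have "z \<in> set (w # ys)" "z \<in> set (w' # ys')"
    using path_edges_subset_set[OF 1(2)] path_edges_subset_set[OF 2(2)] assms(4,5) \<open>z \<noteq> v\<close> by auto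
  then show False using acyclic_first_step_unique[OF acyclic 1(1) 2(1)] assms(3) by blast
qed

lemma branches_adjacent_iff:
  assumes "f \<in> branch V E v w" "f' \<in> branch V E v w'" "w \<noteq> w'"
  shows "f \<inter> f' \<noteq> {} \<longleftrightarrow> f = {v, w} \<and> f' = {v, w'}"
proof
  assume "f \<inter> f' \<noteq> {}"
  then obtain z where "z \<in> f" "z \<in> f'" by auto
  moreover then have "z = v" using branches_share[OF assms] by blast
  ultimately show "f = {v, w} \<and> f' = {v, w'}" using branch_root assms by blast
qed auto

text \<open>A common edge has an endpoint other than \<open>v\<close>, which the two branches cannot
  share.\<close>

lemma branches_disjoint:
  assumes "w \<noteq> w'"
  shows "branch V E v w \<inter> branch V E v w' = {}"
proof (rule ccontr)
  assume "branch V E v w \<inter> branch V E v w' \<noteq> {}"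
  then obtain f where f: "f \<in> branch V E v w" "f \<in> branch V E v w'" by auto
  have "card f = 2" using edge_card[OF subsetD[OF branch_subset f(1)]] .
  then obtain z where "z \<in> f" "z \<noteq> v" by (auto simp: card_2_iff)
  then show False using branches_share[OF f assms] by blast
qed

lemma branch_extend:
  assumes "{u, v} \<in> E" "w \<noteq> u" "is_path V E (v # w # ys)"
  shows "is_path V E (u # v # w # ys)"
proof -
  have "u \<notin> set (w # ys)" using acyclic_no_return[OF acyclic assms(3,1)] assms(2) by blast
  then show ?thesis using assms edge_neq[OF assms(1)] edge_subset[OF assms(1)]
    by (auto simp: is_path_Cons2)
qed

text \<open>Dropping or prepending the first vertex \<open>u\<close> of a path relates the branch to
  those one level below; this is the recursion on which the counting runs.\<close>

lemma branch_decompose: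
  assumes e: "{u, v} \<in> E"
  shows "branch V E u v = insert {u, v} (\<Union>w\<in>nbrs v - {u}. branch V E v w)"
proof (intro equalityI subsetI)
  fix f assume "f \<in> branch V E u v"
  then obtain ys where p: "is_path V E (u # v # ys)" and f: "f \<in> path_edges (u # v # ys)"
    by (rule branch_memE)
  show "f \<in> insert {u, v} (\<Union>w\<in>nbrs v - {u}. branch V E v w)"
  proof (cases ys)
    case Nil
    then show ?thesis using f by simp
  next
    case (Cons w zs)
    then have "w \<in> nbrs v - {u}" "is_path V E (v # w # zs)"
      using p by (auto simp: is_path_Cons2 nbrs_def)
    then show ?thesis using f Cons unfolding branch_def by auto
  qed
next
  fix f assume "f \<in> insert {u, v} (\<Union>w\<in>nbrs v - {u}. branch V E v w)"
  then consider "f = {u, v}" | w where "w \<in> nbrs v - {u}" "f \<in> branch V E v w" by auto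
  then show "f \<in> branch V E u v"
  proof cases
    case 1
    then show ?thesis using edge_in_branch[OF e] by simp
  next
    case (2 w)
    obtain ys where p: "is_path V E (v # w # ys)" "f \<in> path_edges (v # w # ys)"
      using 2(2) by (rule branch_memE)
    have "is_path V E (u # v # w # ys)" using branch_extend[OF e _ p(1)] 2(1) by auto
    moreover have "f \<in> path_edges (u # v # w # ys)" using p(2) by simp
    ultimately show ?thesis unfolding branch_def by blast
  qed
qed

text \<open>Take a path from \<open>v\<close> to one endpoint of an edge. If the other endpoint lies
  on it, acyclicity puts the edge on the path; otherwise the path extends along the edge.\<close>

lemma edges_decompose:
  assumes v: "v \<in> V"
  shows "E = (\<Union>w\<in>nbrs v. branch V E v w)"
proof (intro equalityI subsetI)
  fix f assume f: "f \<in> E"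
  obtain x y where xy: "f = {x, y}" "x \<noteq> y" using edge_card[OF f] by (auto simp: card_2_iff)
  have xyV: "x \<in> V" "y \<in> V" using edge_subset[OF f] xy by auto
  obtain p where p: "is_path V E p" "hd p = v" "last p = x"
    using connected v xyV unfolding graph_connected_def by blast
  have "\<exists>p. is_path V E p \<and> hd p = v \<and> f \<in> path_edges p"
  proof (cases "y \<in> set p")
    case True
    then have "f \<in> path_edges p"
      using acyclic_edge_at_path_end[OF acyclic p(1), of y] f xy p(3) by auto
    then show ?thesis using p by blast
  next
    case False
    have ne: "p \<noteq> []" using p(1) by (simp add: is_path_def)
    have "is_path V E [y]" using xyV by (simp add: is_path_def)
    then have "is_path V E (p @ [y])"
      using ne p False f xy by (subst is_path_append_iff) auto
    moreover have "f \<in> path_edges (p @ [y])" using ne p(3) xy by (simp add: path_edges_append)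
    ultimately show ?thesis using p(2) ne by (metis hd_append2)
  qed
  then obtain p where p: "is_path V E p" "hd p = v" "f \<in> path_edges p" by blast
  then obtain w ys where eq: "p = v # w # ys"
    by (cases p; cases "tl p") auto
  then have "w \<in> nbrs v" using p(1) by (simp add: is_path_Cons2 nbrs_def)
  moreover have "f \<in> branch V E v w" using p(1,3) unfolding branch_def eq by blast
  ultimately show "f \<in> (\<Union>w\<in>nbrs v. branch V E v w)" by blast
next
  fix f assume "f \<in> (\<Union>w\<in>nbrs v. branch V E v w)"
  then show "f \<in> E" by (auto dest: subsetD[OF branch_subset])
qed

end

section \<open>Counting colorings branch by branch\<close>

text \<open>Pins outside \<open>B\<close> are dropped, so one pinning of the whole tree serves every
  branch.\<close>

definition pinned_colorings ::
    "nat \<Rightarrow> 'v set set \<Rightarrow> ('v set \<Rightarrow> nat) \<Rightarrow> 'v set set \<Rightarrow> ('v set \<Rightarrow> nat) set" where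
  "pinned_colorings q \<Lambda> \<tau> B = proper_colorings q B \<inter> agreeing (\<Lambda> \<inter> B) \<tau>"

definition coloring_weight ::
    "nat \<Rightarrow> 'v set set \<Rightarrow> ('v set \<Rightarrow> nat) \<Rightarrow> 'v set \<Rightarrow> 'v set set \<Rightarrow> nat \<Rightarrow> real" where
  "coloring_weight q \<Lambda> \<tau> f B c = real (card {\<sigma> \<in> pinned_colorings q \<Lambda> \<tau> B. \<sigma> f = c})"

lemma finite_proper_colorings: "finite B \<Longrightarrow> finite (proper_colorings q B)"
  unfolding proper_colorings_def
  by (intro finite_subset[OF _ finite_PiE[of B "\<lambda>_. {1..q}"]]) auto

lemma finite_pinned_colorings: "finite B \<Longrightarrow> finite (pinned_colorings q \<Lambda> \<tau> B)"
  by (simp add: pinned_colorings_def finite_proper_colorings)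

lemma coloring_weight_nonneg: "0 \<le> coloring_weight q \<Lambda> \<tau> f B c"
  by (simp add: coloring_weight_def)

text \<open>Lets the parent edge count as a branch of weight 1 at its lower endpoint.\<close>

lemma coloring_weight_singleton:
  assumes "e \<notin> \<Lambda>" "c \<in> {1..q}"
  shows "coloring_weight q \<Lambda> \<tau> e {e} c = 1"
proof -
  have "{\<sigma> \<in> pinned_colorings q \<Lambda> \<tau> {e}. \<sigma> e = c} = {\<lambda>x\<in>{e}. c}"
    using assms by (auto simp: pinned_colorings_def proper_colorings_def agreeing_def PiE_iff
      extensional_def fun_eq_iff split: if_splits)
  then show ?thesis by (simp add: coloring_weight_def)
qed

text \<open>The branches at a vertex interact only through their root edges, which form a clique.\<close>

locale star =
  fixes I :: "'i set" and r :: "'i \<Rightarrow> 'v set" and Bs :: "'i \<Rightarrow> 'v set set"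
  assumes finI: "finite I" and finB: "i \<in> I \<Longrightarrow> finite (Bs i)" and root: "i \<in> I \<Longrightarrow> r i \<in> Bs i"
    and disj: "i \<in> I \<Longrightarrow> j \<in> I \<Longrightarrow> i \<noteq> j \<Longrightarrow> Bs i \<inter> Bs j = {}"
    and adj: "i \<in> I \<Longrightarrow> j \<in> I \<Longrightarrow> i \<noteq> j \<Longrightarrow> x \<in> Bs i \<Longrightarrow> y \<in> Bs j \<Longrightarrow>
      x \<inter> y \<noteq> {} \<longleftrightarrow> x = r i \<and> y = r j"
begin

text \<open>Restricting to the branches and gluing are inverse to each other. Conflicts between
  different branches occur only at root edges, which is the injectivity condition on the
  right.\<close>

lemma pinned_colorings_bij:
  "bij_betw (\<lambda>\<sigma>. \<lambda>i\<in>I. restrict \<sigma> (Bs i)) (pinned_colorings q \<Lambda> \<tau> (\<Union>i\<in>I. Bs i))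
    {h \<in> \<Pi>\<^sub>E i\<in>I. pinned_colorings q \<Lambda> \<tau> (Bs i). inj_on (\<lambda>i. h i (r i)) I}"
proof -
  let ?B = "\<Union>i\<in>I. Bs i"
  let ?\<Phi> = "\<lambda>\<sigma>. \<lambda>i\<in>I. restrict \<sigma> (Bs i)"
  \<comment> \<open>The branch containing a given edge, unique by \<open>disj\<close>; the gluing
    map \<Psi> reads each color from that branch.\<close>
  define k where "k x = (THE i. i \<in> I \<and> x \<in> Bs i)" for x
  have k: "k x = i" if "i \<in> I" "x \<in> Bs i" for x i
    unfolding k_def using that disj by (intro the_equality) auto
  define \<Psi> where "\<Psi> h = (\<lambda>x\<in>?B. h (k x) x)" for h :: "'i \<Rightarrow> 'v set \<Rightarrow> nat"
  have \<Psi>: "\<Psi> h x = h i x" if "i \<in> I" "x \<in> Bs i" for h x i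
    using that k[OF that] by (auto simp: \<Psi>_def)
  show ?thesis
  proof (rule bij_betw_byWitness[where f'=\<Psi>])
    show "\<forall>\<sigma>\<in>pinned_colorings q \<Lambda> \<tau> ?B. \<Psi> (?\<Phi> \<sigma>) = \<sigma>"
    proof
      fix \<sigma> assume \<sigma>: "\<sigma> \<in> pinned_colorings q \<Lambda> \<tau> ?B"
      show "\<Psi> (?\<Phi> \<sigma>) = \<sigma>"
      proof
        fix x
        show "\<Psi> (?\<Phi> \<sigma>) x = \<sigma> x"
        proof (cases "x \<in> ?B")
          case True
          then obtain i where "i \<in> I" "x \<in> Bs i" by auto
          then show ?thesis by (simp add: \<Psi>)
        next
          case False
          then have "\<sigma> x = undefined"
            using \<sigma> by (auto simp: pinned_colorings_def proper_colorings_def PiE_iff extensional_def)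
          then show ?thesis using False by (simp add: \<Psi>_def)
        qed
      qed
    qed
    show "\<forall>h\<in>{h \<in> \<Pi>\<^sub>E i\<in>I. pinned_colorings q \<Lambda> \<tau> (Bs i). inj_on (\<lambda>i. h i (r i)) I}. ?\<Phi> (\<Psi> h) = h"
    proof clarify
      fix h assume h: "h \<in> (\<Pi>\<^sub>E i\<in>I. pinned_colorings q \<Lambda> \<tau> (Bs i))"
      have "restrict (\<Psi> h) (Bs i) = h i" if i: "i \<in> I" for i
      proof
        fix x
        have "h i \<in> extensional (Bs i)"
          using h i by (auto simp: pinned_colorings_def proper_colorings_def PiE_iff)
        then show "restrict (\<Psi> h) (Bs i) x = h i x"
          using i by (auto simp: \<Psi> restrict_def extensional_def)
      qed
      then show "?\<Phi> (\<Psi> h) = h" using h by (auto simp: fun_eq_iff PiE_iff extensional_def restrict_def)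
    qed
    show "?\<Phi> ` pinned_colorings q \<Lambda> \<tau> ?B \<subseteq>
      {h \<in> \<Pi>\<^sub>E i\<in>I. pinned_colorings q \<Lambda> \<tau> (Bs i). inj_on (\<lambda>i. h i (r i)) I}"
    proof clarify
      fix \<sigma> assume \<sigma>: "\<sigma> \<in> pinned_colorings q \<Lambda> \<tau> ?B"
      have "restrict \<sigma> (Bs i) \<in> pinned_colorings q \<Lambda> \<tau> (Bs i)" if "i \<in> I" for i
        using \<sigma> that by (auto simp: pinned_colorings_def proper_colorings_def agreeing_def PiE_iff)
      moreover have "inj_on (\<lambda>i. ?\<Phi> \<sigma> i (r i)) I"
      proof (rule inj_onI, rule ccontr)
        fix i j assume ij: "i \<in> I" "j \<in> I" "?\<Phi> \<sigma> i (r i) = ?\<Phi> \<sigma> j (r j)" "i \<noteq> j"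
        have "r i \<inter> r j \<noteq> {}" using adj[OF ij(1,2,4) root root] ij by auto
        moreover have "r i \<noteq> r j" using disj[OF ij(1,2,4)] root[OF ij(1)] root[OF ij(2)] by auto
        moreover have "\<sigma> (r i) = \<sigma> (r j)" using ij root by auto
        moreover have "r i \<in> ?B" "r j \<in> ?B" using ij root by auto
        ultimately show False using \<sigma> unfolding pinned_colorings_def proper_colorings_def by blast
      qed
      ultimately show "?\<Phi> \<sigma> \<in> (\<Pi>\<^sub>E i\<in>I. pinned_colorings q \<Lambda> \<tau> (Bs i)) \<and> inj_on (\<lambda>i. ?\<Phi> \<sigma> i (r i)) I"
        by auto
    qed
    show "\<Psi> ` {h \<in> \<Pi>\<^sub>E i\<in>I. pinned_colorings q \<Lambda> \<tau> (Bs i). inj_on (\<lambda>i. h i (r i)) I}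
      \<subseteq> pinned_colorings q \<Lambda> \<tau> ?B"
    proof clarify
      fix h assume h: "h \<in> (\<Pi>\<^sub>E i\<in>I. pinned_colorings q \<Lambda> \<tau> (Bs i))"
        and inj: "inj_on (\<lambda>i. h i (r i)) I"
      have hi: "h i \<in> pinned_colorings q \<Lambda> \<tau> (Bs i)" if "i \<in> I" for i using h that by auto
      have "\<Psi> h x \<in> {1..q}" if x: "x \<in> ?B" for x
      proof -
        obtain i where i: "i \<in> I" "x \<in> Bs i" using x by auto
        then show ?thesis using hi[OF i(1)] \<Psi>[OF i]
          by (auto simp: pinned_colorings_def proper_colorings_def PiE_iff)
      qed
      then have "\<Psi> h \<in> ?B \<rightarrow>\<^sub>E {1..q}" by (auto simp: \<Psi>_def)
      moreover have "\<Psi> h x \<noteq> \<Psi> h y" if xy: "x \<in> ?B" "y \<in> ?B" "x \<noteq> y" "x \<inter> y \<noteq> {}" for x y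
      proof -
        obtain i j where i: "i \<in> I" "x \<in> Bs i" and j: "j \<in> I" "y \<in> Bs j" using xy by auto
        show ?thesis
        proof (cases "i = j")
          case True
          then have "h i x \<noteq> h i y"
            using hi[OF i(1)] xy i j unfolding pinned_colorings_def proper_colorings_def by blast
          then show ?thesis using True \<Psi>[OF i] \<Psi>[OF j] by simp
        next
          case False
          then have "x = r i" "y = r j" using adj[OF i(1) j(1) False i(2) j(2)] xy by auto
          then show ?thesis using False \<Psi>[OF i] \<Psi>[OF j] inj i j by (auto dest: inj_onD)
        qed
      qed
      moreover have "\<Psi> h \<in> agreeing (\<Lambda> \<inter> ?B) \<tau>"
      proof -
        have "\<Psi> h x = \<tau> x" if "i \<in> I" "x \<in> Bs i" "x \<in> \<Lambda>" for i x
          using that hi[OF that(1)] \<Psi>[OF that(1,2)] by (auto simp: pinned_colorings_def agreeing_def)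
        then show ?thesis by (auto simp: agreeing_def)
      qed
      ultimately show "\<Psi> h \<in> pinned_colorings q \<Lambda> \<tau> ?B"
        unfolding pinned_colorings_def proper_colorings_def by blast
    qed
  qed
qed

text \<open>Once the root edges have their colors, the branches are colored independently, which
  gives a product. Summing over the admissible root colors gives \<open>inj_sum\<close>.\<close>

lemma coloring_weight_star:
  assumes e: "e \<in> I" and c: "c \<in> {1..q}"
  shows "coloring_weight q \<Lambda> \<tau> (r e) (\<Union>i\<in>I. Bs i) c =
    coloring_weight q \<Lambda> \<tau> (r e) (Bs e) c *
    inj_sum q (I - {e}) (\<lambda>i. coloring_weight q \<Lambda> \<tau> (r i) (Bs i)) {c}"
proof -
  let ?B = "\<Union>i\<in>I. Bs i" and ?J = "I - {e}"
  let ?col = "\<lambda>i. pinned_colorings q \<Lambda> \<tau> (Bs i)"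
  let ?\<Phi> = "\<lambda>\<sigma>. \<lambda>i\<in>I. restrict \<sigma> (Bs i)"
  let ?H = "{h \<in> \<Pi>\<^sub>E i\<in>I. ?col i. inj_on (\<lambda>i. h i (r i)) I}"
  let ?G = "\<lambda>g. \<Pi>\<^sub>E i\<in>I. {\<sigma> \<in> ?col i. \<sigma> (r i) = (if i = e then c else g i)}"
  have bij: "bij_betw ?\<Phi> {\<sigma> \<in> pinned_colorings q \<Lambda> \<tau> ?B. \<sigma> (r e) = c} {h \<in> ?H. h e (r e) = c}"
  proof (rule bij_betw_subset[OF pinned_colorings_bij])
    show "?\<Phi> ` {\<sigma> \<in> pinned_colorings q \<Lambda> \<tau> ?B. \<sigma> (r e) = c} = {h \<in> ?H. h e (r e) = c}" (is "?L = ?R")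
    proof -
      have im: "?\<Phi> ` pinned_colorings q \<Lambda> \<tau> ?B = ?H"
        using pinned_colorings_bij by (auto simp: bij_betw_def)
      have "?\<Phi> \<sigma> e (r e) = \<sigma> (r e)" for \<sigma> :: "'v set \<Rightarrow> nat" using e root by simp
      then show ?thesis unfolding im[symmetric] by auto
    qed
  qed auto
  \<comment> \<open>Sorts the tuples by their root colors: \<open>c\<close> at \<open>e\<close>, and
    an injection \<open>g\<close> avoiding \<open>c\<close> elsewhere.\<close>
  have un: "{h \<in> ?H. h e (r e) = c} = (\<Union>g\<in>inj_maps q ?J {c}. ?G g)"
  proof (intro equalityI subsetI)
    fix h assume h: "h \<in> {h \<in> ?H. h e (r e) = c}"
    define g where "g = (\<lambda>i\<in>?J. h i (r i))"
    have col: "h i (r i) \<in> {1..q}" if "i \<in> I" for i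
    proof -
      have "h i \<in> ?col i" using h that by auto
      then show ?thesis using root[OF that] by (auto simp: pinned_colorings_def proper_colorings_def PiE_iff)
    qed
    have "g i \<noteq> c" if "i \<in> ?J" for i
      using h that e by (auto simp: g_def dest!: inj_onD)
    then have "g \<in> inj_maps q ?J {c}"
      using col h by (auto simp: inj_maps_def g_def inj_on_def)
    moreover have "h \<in> ?G g" using h by (auto simp: g_def PiE_iff)
    ultimately show "h \<in> (\<Union>g\<in>inj_maps q ?J {c}. ?G g)" by blast
  next
    fix h assume "h \<in> (\<Union>g\<in>inj_maps q ?J {c}. ?G g)"
    then obtain g where g: "g \<in> inj_maps q ?J {c}" and h: "h \<in> ?G g" by blast
    have eq: "h i (r i) = (if i = e then c else g i)" if "i \<in> I" for i using h that by (auto simp: PiE_iff)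
    have "inj_on (\<lambda>i. h i (r i)) I"
    proof (rule inj_onI)
      fix i j assume ij: "i \<in> I" "j \<in> I" "h i (r i) = h j (r j)"
      have "g i \<noteq> c" if "i \<in> ?J" for i using g that by (auto simp: inj_maps_def PiE_iff)
      then show "i = j" using ij g
        by (auto simp: eq inj_maps_def inj_on_def split: if_splits)
    qed
    then show "h \<in> {h \<in> ?H. h e (r e) = c}" using h eq[OF e] by (auto simp: PiE_iff)
  qed
  have disjG: "?G g \<inter> ?G g' = {}" if g: "g \<in> inj_maps q ?J {c}" "g' \<in> inj_maps q ?J {c}" "g \<noteq> g'" for g g'
  proof (rule ccontr)
    assume "?G g \<inter> ?G g' \<noteq> {}"
    then obtain h where h: "h \<in> ?G g" "h \<in> ?G g'" by blast
    have "g i = g' i" for i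
    proof (cases "i \<in> ?J")
      case True
      then show ?thesis using h by (auto simp: PiE_iff)
    next
      case False
      then show ?thesis using g(1,2) by (auto simp: inj_maps_def PiE_iff extensional_def)
    qed
    then show False using g(3) by auto
  qed
  have finG: "finite (?G g)" for g
    using finI finB by (intro finite_PiE finite_Collect_conjI disjI1) (auto simp: finite_pinned_colorings)
  have "card {\<sigma> \<in> pinned_colorings q \<Lambda> \<tau> ?B. \<sigma> (r e) = c} = card (\<Union>g\<in>inj_maps q ?J {c}. ?G g)"
    using bij_betw_same_card[OF bij] unfolding un .
  also have "\<dots> = (\<Sum>g\<in>inj_maps q ?J {c}. card (?G g))"
    using finI finG disjG by (intro card_UN_disjoint) (auto simp: finite_inj_maps)
  also have "\<dots> = (\<Sum>g\<in>inj_maps q ?J {c}. \<Prod>i\<in>I. card {\<sigma> \<in> ?col i. \<sigma> (r i) = (if i = e then c else g i)})"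
    using finI by (simp add: card_PiE)
  finally have "coloring_weight q \<Lambda> \<tau> (r e) ?B c =
     (\<Sum>g\<in>inj_maps q ?J {c}. \<Prod>i\<in>I. coloring_weight q \<Lambda> \<tau> (r i) (Bs i) (if i = e then c else g i))"
    by (simp add: coloring_weight_def)
  also have "\<dots> = (\<Sum>g\<in>inj_maps q ?J {c}. coloring_weight q \<Lambda> \<tau> (r e) (Bs e) c *
      (\<Prod>i\<in>?J. coloring_weight q \<Lambda> \<tau> (r i) (Bs i) (g i)))"
    by (intro sum.cong refl, subst prod.remove[OF finI e]) (auto intro!: prod.cong)
  finally show ?thesis by (simp add: inj_sum_def sum_distrib_left)
qed

end

section \<open>Mixing above the threshold\<close>

context tree
begin

lemma star_branches:
  assumes "\<And>w. w \<in> nbrs v \<Longrightarrow> {v, w} \<in> Bs w \<and> Bs w \<subseteq> branch V E v w"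
  shows "star (nbrs v) (\<lambda>w. {v, w}) Bs"
proof
  show "finite (nbrs v)" by (rule finite_nbrs)
  show "finite (Bs w)" if "w \<in> nbrs v" for w
    using assms[OF that] branch_subset[of V E v w] finite_E by (meson finite_subset)
  show "{v, w} \<in> Bs w" if "w \<in> nbrs v" for w using assms[OF that] by blast
  show "Bs w \<inter> Bs w' = {}" if "w \<in> nbrs v" "w' \<in> nbrs v" "w \<noteq> w'" for w w'
    using assms[OF that(1)] assms[OF that(2)] branches_disjoint[OF that(3), of v] by blast
  show "x \<inter> y \<noteq> {} \<longleftrightarrow> x = {v, w} \<and> y = {v, w'}"
    if "w \<in> nbrs v" "w' \<in> nbrs v" "w \<noteq> w'" "x \<in> Bs w" "y \<in> Bs w'" for w w' x y
    using assms[OF that(1)] assms[OF that(2)] that by (intro branches_adjacent_iff) auto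
qed

text \<open>The recursion for branch weights: the star formula at \<open>v\<close>, with the side of
  \<open>u\<close> reduced to the unpinned edge \<open>{u, v}\<close>, whose own weight is
  1.\<close>

lemma coloring_weight_branch:
  assumes e: "{u, v} \<in> E" "{u, v} \<notin> \<Lambda>" and c: "c \<in> {1..q}"
  shows "coloring_weight q \<Lambda> \<tau> {u, v} (branch V E u v) c =
    inj_sum q (nbrs v - {u}) (\<lambda>w. coloring_weight q \<Lambda> \<tau> {v, w} (branch V E v w)) {c}"
proof -
  let ?Bs = "\<lambda>w. if w = u then {{v, w}} else branch V E v w"
  have u: "u \<in> nbrs v" using e(1) by (simp add: nbrs_def insert_commute)
  interpret star "nbrs v" "\<lambda>w. {v, w}" ?Bs
    by (rule star_branches) (auto simp: nbrs_def edge_in_branch)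
  have un: "(\<Union>w\<in>nbrs v. ?Bs w) = branch V E u v"
    unfolding branch_decompose[OF e(1)] using u by (auto simp: insert_commute split: if_splits)
  have "coloring_weight q \<Lambda> \<tau> {v, u} (branch V E u v) c = coloring_weight q \<Lambda> \<tau> {v, u} {{v, u}} c *
      inj_sum q (nbrs v - {u}) (\<lambda>w. coloring_weight q \<Lambda> \<tau> {v, w} (?Bs w)) {c}"
    using coloring_weight_star[OF u c, of \<Lambda> \<tau>] un by simp
  also have "coloring_weight q \<Lambda> \<tau> {v, u} {{v, u}} c = 1"
    by (rule coloring_weight_singleton) (use e c in \<open>auto simp: insert_commute\<close>)
  also have "inj_sum q (nbrs v - {u}) (\<lambda>w. coloring_weight q \<Lambda> \<tau> {v, w} (?Bs w)) {c} =
      inj_sum q (nbrs v - {u}) (\<lambda>w. coloring_weight q \<Lambda> \<tau> {v, w} (branch V E v w)) {c}"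
    unfolding inj_sum_def by (intro sum.cong prod.cong) auto
  finally show ?thesis by (simp add: insert_commute)
qed

text \<open>The star formula at \<open>v\<close> with all branches: one factor is the side of
  \<open>u\<close>, and by the recursion the sum over the others is the branch weight of the side of
  \<open>v\<close>.\<close>

lemma coloring_weight_edge:
  assumes e: "{u, v} \<in> E" "{u, v} \<notin> \<Lambda>" and c: "c \<in> {1..q}"
  shows "coloring_weight q \<Lambda> \<tau> {u, v} E c =
    coloring_weight q \<Lambda> \<tau> {v, u} (branch V E v u) c * coloring_weight q \<Lambda> \<tau> {u, v} (branch V E u v) c"
proof -
  have u: "u \<in> nbrs v" and v: "v \<in> V"
    using e(1) edge_subset[OF e(1)] by (auto simp: nbrs_def insert_commute)
  interpret star "nbrs v" "\<lambda>w. {v, w}" "branch V E v"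
    by (rule star_branches) (auto simp: nbrs_def edge_in_branch)
  show ?thesis
    using coloring_weight_star[OF u c, of \<Lambda> \<tau>] edges_decompose[OF v]
      coloring_weight_branch[OF e c, of \<tau>] by (simp add: insert_commute)
qed

text \<open>The condition \<open>length xs < n\<close> says that the first \<open>n\<close> levels
  are unpinned, \<open>{u, v}\<close> being the first. Prepending \<open>u\<close> carries it over
  to the children with \<open>n\<close> lowered by one.\<close>

lemma mixing_weight_branch:
  assumes "max_degree V E \<ge> 2" "q \<ge> 2 * max_degree V E - 1" "{u, v} \<in> E"
    and free: "\<And>xs. is_path V E (u # v # xs) \<Longrightarrow> length xs < n \<Longrightarrow> path_edges (u # v # xs) \<inter> \<Lambda> = {}"
  shows "mixing_weight (max_degree V E) q n (coloring_weight q \<Lambda> \<tau> {u, v} (branch V E u v))"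
  using assms(3) free
proof (induction n arbitrary: u v)
  case 0
  then show ?case by (intro mixing_weight_0 coloring_weight_nonneg)
next
  case (Suc n)
  let ?w = "\<lambda>w. coloring_weight q \<Lambda> \<tau> {v, w} (branch V E v w)"
  have "is_path V E (u # v # [])"
    using Suc.prems(1) edge_neq edge_subset[OF Suc.prems(1)] by (auto simp: is_path_def)
  then have notin: "{u, v} \<notin> \<Lambda>" using Suc.prems(2)[of "[]"] by auto
  have v: "v \<in> V" using edge_subset[OF Suc.prems(1)] by simp
  have u: "u \<in> nbrs v" using Suc.prems(1) by (simp add: nbrs_def insert_commute)
  have "mixing_weight (max_degree V E) q n (?w w)" if w: "w \<in> nbrs v - {u}" for w
  proof (rule Suc.IH)
    show "{v, w} \<in> E" using w by (simp add: nbrs_def)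
    fix xs assume p: "is_path V E (v # w # xs)" and "length xs < n"
    moreover have "is_path V E (u # v # w # xs)" using branch_extend[OF Suc.prems(1) _ p] w by auto
    ultimately have "path_edges (u # v # w # xs) \<inter> \<Lambda> = {}" by (intro Suc.prems(2)) auto
    then show "path_edges (v # w # xs) \<inter> \<Lambda> = {}" by auto
  qed
  moreover have "card (nbrs v - {u}) + 1 \<le> max_degree V E"
    using card_nbrs_le[OF v] card.remove[OF finite_nbrs u] by simp
  ultimately have "mixing_weight (max_degree V E) q (Suc n) (\<lambda>c. inj_sum q (nbrs v - {u}) ?w {c})"
    using assms finite_nbrs by (intro mixing_weight_step) auto
  then show ?case
    by (rule mixing_weight_cong[rotated 2])
      (auto simp: coloring_weight_branch[OF Suc.prems(1) notin] coloring_weight_nonneg)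
qed

text \<open>If the path ran through a pinned edge, its part from \<open>v\<close> to the near end of
  that edge would witness a distance below \<open>K\<close>.\<close>

lemma free_of_edge_dist:
  assumes e: "{u, v} \<in> E" "{u, v} \<notin> \<Lambda>" and d: "\<And>f. f \<in> \<Lambda> \<Longrightarrow> K \<le> edge_dist V E {u, v} f"
    and p: "is_path V E (u # v # xs)" and len: "length xs \<le> K"
  shows "path_edges (u # v # xs) \<inter> \<Lambda> = {}"
proof (rule ccontr)
  assume "path_edges (u # v # xs) \<inter> \<Lambda> \<noteq> {}"
  then obtain f where f: "f \<in> path_edges (v # xs)" "f \<in> \<Lambda>" using e(2) by auto
  then obtain i where i: "Suc i < length (v # xs)" "f = {(v # xs) ! i, (v # xs) ! Suc i}"
    by (auto simp: path_edges_def)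
  \<comment> \<open>Stops at the near endpoint of \<open>f\<close>: it has length \<open>i\<close>
    and contains neither \<open>u\<close> nor the far endpoint, hence neither of the two
    edges.\<close>
  let ?ys = "take (Suc i) (v # xs)"
  have pv: "is_path V E (v # xs)" "u \<notin> set (v # xs)" using p by (auto simp: is_path_Cons2)
  have ys: "is_path V E ?ys" by (rule is_path_prefix[of V E _ "drop (Suc i) (v # xs)"]) (use pv in auto)
  have "set ?ys \<subseteq> set (v # xs)" by (rule set_take_subset)
  then have "{u, v} \<notin> path_edges ?ys" using pv(2) path_edges_subset_set[of "{u, v}" ?ys] by blast
  moreover have "(v # xs) ! Suc i \<notin> set ?ys"
  proof
    assume "(v # xs) ! Suc i \<in> set ?ys"
    then obtain j where "j < Suc i" "(v # xs) ! j = (v # xs) ! Suc i"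
      using i(1) by (auto simp only: in_set_conv_nth length_take nth_take min_less_iff_conj)
    then show False using pv(1) i(1) nth_eq_iff_index_eq[of "v # xs" j "Suc i"] by (auto simp: is_path_def)
  qed
  then have "f \<notin> path_edges ?ys" using path_edges_subset_set[of f ?ys] i(2) by blast
  moreover have "last ?ys \<in> f" using i by (simp add: last_conv_nth del: take_Suc_Cons)
  moreover have "path_length ?ys = i" using i(1) by (simp add: path_length_def)
  ultimately have "edge_dist V E {u, v} f \<le> i"
    unfolding edge_dist_def using ys by (intro Least_le exI[of _ ?ys]) auto
  then show False using d[OF f(2)] i(1) len by simp
qed

end

text \<open>Writing q N(c) - T as the sum of all N(c) - N(c') turns pairwise deviations into a
  deviation from the mean. The terms N(c)/T and 1/q each sum to 1, whence the factor 2.\<close>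

lemma near_uniform:
  fixes N :: "nat \<Rightarrow> real"
  assumes q: "q > 0" and T: "T = sum N {1..q}" "T > 0"
    and dev: "\<And>c c'. c \<in> {1..q} \<Longrightarrow> c' \<in> {1..q} \<Longrightarrow> \<bar>N c - N c'\<bar> \<le> \<kappa> * (N c + N c')"
  shows "(\<Sum>c\<in>{1..q}. \<bar>N c / T - 1 / real q\<bar>) \<le> 2 * \<kappa>"
proof -
  have "\<bar>N c / T - 1 / real q\<bar> \<le> \<kappa> * (N c / T + 1 / real q)" if c: "c \<in> {1..q}" for c
  proof -
    have "real q * N c - T = (\<Sum>c'\<in>{1..q}. N c - N c')" by (simp add: sum_subtractf T)
    also have "\<bar>\<dots>\<bar> \<le> (\<Sum>c'\<in>{1..q}. \<kappa> * (N c + N c'))"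
      by (rule order_trans[OF sum_abs]) (intro sum_mono dev c)
    also have "\<dots> = \<kappa> * (real q * N c + T)"
      by (simp add: sum_distrib_left[symmetric] sum.distrib T)
    finally have "\<bar>real q * N c - T\<bar> / (real q * T) \<le> \<kappa> * (real q * N c + T) / (real q * T)"
      using q T by (intro divide_right_mono) auto
    moreover have "N c / T - 1 / real q = (real q * N c - T) / (real q * T)"
      "N c / T + 1 / real q = (real q * N c + T) / (real q * T)"
      using q T(2) by (simp_all add: field_simps)
    ultimately show ?thesis using q T(2) by (simp add: abs_divide)
  qed
  then have "(\<Sum>c\<in>{1..q}. \<bar>N c / T - 1 / real q\<bar>) \<le> (\<Sum>c\<in>{1..q}. \<kappa> * (N c / T + 1 / real q))"
    by (intro sum_mono) auto
  also have "\<dots> = \<kappa> * (sum N {1..q} / T + 1)"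
    using q by (simp add: sum_distrib_left[symmetric] sum.distrib sum_divide_distrib)
  also have "\<dots> = 2 * \<kappa>" using T by simp
  finally show ?thesis .
qed

text \<open>Combines the two sides of an edge; the relative errors add up to a constant multiple of
  \<delta>.\<close>

lemma product_deviation:
  fixes a a' b b' \<delta> :: real
  assumes "0 \<le> a" "0 \<le> a'" "0 \<le> b" "0 \<le> b'" "0 \<le> \<delta>" "\<delta> \<le> 1 / 2"
    and a: "\<bar>a - a'\<bar> \<le> \<delta> * (a + a')" and b: "\<bar>b - b'\<bar> \<le> \<delta> * (b + b')"
  shows "\<bar>a * b - a' * b'\<bar> \<le> 4 * \<delta> * (a * b + a' * b')"
proof -
  have "2 * (a * b - a' * b') = (a - a') * (b + b') + (a + a') * (b - b')" by (simp add: algebra_simps)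
  then have "2 * \<bar>a * b - a' * b'\<bar> = \<bar>(a - a') * (b + b') + (a + a') * (b - b')\<bar>"
    by (metis abs_mult abs_numeral)
  also have "\<dots> \<le> \<bar>a - a'\<bar> * (b + b') + (a + a') * \<bar>b - b'\<bar>"
    using assms by (intro order_trans[OF abs_triangle_ineq]) (simp add: abs_mult)
  also have "\<dots> \<le> (\<delta> * (a + a')) * (b + b') + (a + a') * (\<delta> * (b + b'))"
    using assms by (intro add_mono mult_mono) auto
  finally have 1: "\<bar>a * b - a' * b'\<bar> \<le> \<delta> * ((a + a') * (b + b'))" by (simp add: algebra_simps)
  \<comment> \<open>With \<delta> at most 1/2, \<open>a\<close> and \<open>a'\<close> differ by a
    factor of at most 3. The mixed products are thus at most 3 times the pure ones, which gives the
    constant 4.\<close>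
  have "\<delta> * (a + a') \<le> 1 / 2 * (a + a')" using assms by (intro mult_right_mono) auto
  with a have "\<bar>a - a'\<bar> \<le> 1 / 2 * (a + a')" by (rule order_trans)
  then have "a - a' \<le> 1 / 2 * (a + a')" "a' - a \<le> 1 / 2 * (a + a')" unfolding abs_le_iff by simp_all
  then have "a \<le> 3 * a'" "a' \<le> 3 * a" by (simp_all add: field_simps)
  then have "a * b' \<le> (3 * a') * b'" "a' * b \<le> (3 * a) * b" using assms by (auto intro: mult_right_mono)
  then have "(a + a') * (b + b') \<le> 4 * (a * b + a' * b')" by (simp add: algebra_simps)
  then have "\<delta> * ((a + a') * (b + b')) \<le> \<delta> * (4 * (a * b + a' * b'))"
    by (intro mult_left_mono assms(5))
  with 1 have "\<bar>a * b - a' * b'\<bar> \<le> \<delta> * (4 * (a * b + a' * b'))" by (rule order_trans)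
  then show ?thesis by (simp only: mult_ac)
qed

section \<open>Total variation distance and conditional marginals\<close>

lemma tv_dist_leI:
  "(\<And>A. \<bar>measure_pmf.prob p A - measure_pmf.prob r A\<bar> \<le> x) \<Longrightarrow> tv_dist p r \<le> x"
  unfolding tv_dist_def by (rule cSUP_least) auto

lemma tv_dist_le_1: "tv_dist p r \<le> 1"
proof (rule tv_dist_leI)
  fix A
  have "0 \<le> measure_pmf.prob p A" "0 \<le> measure_pmf.prob r A"
    "measure_pmf.prob p A \<le> 1" "measure_pmf.prob r A \<le> 1" by simp_all
  then show "\<bar>measure_pmf.prob p A - measure_pmf.prob r A\<bar> \<le> 1" by linarith
qed

lemma tv_dist_le_sum:
  assumes S: "finite S" "set_pmf p \<subseteq> S" "set_pmf r \<subseteq> S"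
  shows "tv_dist p r \<le> (\<Sum>c\<in>S. \<bar>pmf p c - pmf r c\<bar>)"
proof (rule tv_dist_leI)
  fix A
  have eq: "measure_pmf.prob p' A = (\<Sum>c\<in>A \<inter> S. pmf p' c)" if "set_pmf p' \<subseteq> S" for p'
  proof -
    have "A \<inter> set_pmf p' = A \<inter> S \<inter> set_pmf p'" using that by auto
    then have "measure_pmf.prob p' A = measure_pmf.prob p' (A \<inter> S)"
      by (metis measure_Int_set_pmf)
    then show ?thesis using S(1) by (simp add: measure_measure_pmf_finite)
  qed
  have "\<bar>measure_pmf.prob p A - measure_pmf.prob r A\<bar> = \<bar>\<Sum>c\<in>A \<inter> S. pmf p c - pmf r c\<bar>"
    by (simp add: eq S sum_subtractf)
  also have "\<dots> \<le> (\<Sum>c\<in>A \<inter> S. \<bar>pmf p c - pmf r c\<bar>)" by (rule sum_abs)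
  also have "\<dots> \<le> (\<Sum>c\<in>S. \<bar>pmf p c - pmf r c\<bar>)" using S(1) by (intro sum_mono2) auto
  finally show "\<bar>measure_pmf.prob p A - measure_pmf.prob r A\<bar> \<le> (\<Sum>c\<in>S. \<bar>pmf p c - pmf r c\<bar>)" .
qed

lemma cond_uniform_coloring:
  assumes "finite E" "\<tau> \<in> feasible_pinnings q E \<Lambda>"
  shows "cond_pmf (uniform_coloring q E) (agreeing \<Lambda> \<tau>) =
    pmf_of_set (proper_colorings q E \<inter> agreeing \<Lambda> \<tau>)"
proof -
  let ?P = "proper_colorings q E" and ?A = "agreeing \<Lambda> \<tau>"
  have fin: "finite ?P" "finite (?P \<inter> ?A)" and ne: "?P \<inter> ?A \<noteq> {}" "?P \<noteq> {}"
    using assms by (auto simp: feasible_pinnings_def finite_proper_colorings)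
  then have "set_pmf (pmf_of_set ?P) \<inter> ?A \<noteq> {}" by simp
  then show ?thesis
    unfolding uniform_coloring_def
    by (intro pmf_eqI)
      (use fin ne in \<open>auto simp: pmf_cond measure_pmf_of_set indicator_def card_gt_0_iff\<close>)
qed

lemma set_pmf_pinned_marginal:
  assumes "finite E" "\<tau> \<in> feasible_pinnings q E \<Lambda>"
  shows "set_pmf (pinned_marginal q E \<Lambda> \<tau> e) = (\<lambda>\<sigma>. \<sigma> e) ` (proper_colorings q E \<inter> agreeing \<Lambda> \<tau>)"
  unfolding pinned_marginal_def cond_uniform_coloring[OF assms]
  using assms by (auto simp: feasible_pinnings_def finite_proper_colorings)

lemma pmf_pinned_marginal:
  assumes "finite E" "\<tau> \<in> feasible_pinnings q E \<Lambda>" "\<Lambda> \<subseteq> E" "e \<in> E"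
  defines "T \<equiv> sum (coloring_weight q \<Lambda> \<tau> e E) {1..q}"
  shows "pmf (pinned_marginal q E \<Lambda> \<tau> e) c = coloring_weight q \<Lambda> \<tau> e E c / T" "T > 0"
proof -
  let ?\<Omega> = "proper_colorings q E \<inter> agreeing \<Lambda> \<tau>"
  have fin: "finite ?\<Omega>" "?\<Omega> \<noteq> {}"
    using assms by (auto simp: feasible_pinnings_def finite_proper_colorings)
  have \<Omega>: "pinned_colorings q \<Lambda> \<tau> E = ?\<Omega>"
    using assms(3) by (simp add: pinned_colorings_def Int_absorb2)
  have range: "\<sigma> e \<in> {1..q}" if "\<sigma> \<in> ?\<Omega>" for \<sigma>
    using that assms(4) by (auto simp: proper_colorings_def PiE_iff)
  have "card ?\<Omega> = (\<Sum>c\<in>{1..q}. card {\<sigma> \<in> ?\<Omega>. \<sigma> e = c})"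
  proof -
    have "?\<Omega> = (\<Union>c\<in>{1..q}. {\<sigma> \<in> ?\<Omega>. \<sigma> e = c})" using range by auto
    then have "card ?\<Omega> = card (\<Union>c\<in>{1..q}. {\<sigma> \<in> ?\<Omega>. \<sigma> e = c})" by (rule arg_cong)
    also have "\<dots> = (\<Sum>c\<in>{1..q}. card {\<sigma> \<in> ?\<Omega>. \<sigma> e = c})"
    proof (intro card_UN_disjoint ballI impI)
      show "finite {\<sigma> \<in> ?\<Omega>. \<sigma> e = c}" for c using fin(1) by (rule rev_finite_subset) auto
    qed auto
    finally show ?thesis .
  qed
  then have T: "T = real (card ?\<Omega>)"
    by (simp add: T_def coloring_weight_def \<Omega>)
  then show "T > 0" using fin by (simp add: card_gt_0_iff)
  have "pmf (pinned_marginal q E \<Lambda> \<tau> e) c = measure_pmf.prob (pmf_of_set ?\<Omega>) ((\<lambda>\<sigma>. \<sigma> e) -` {c})"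
    unfolding pinned_marginal_def cond_uniform_coloring[OF assms(1,2)] by (simp add: pmf_map)
  also have "\<dots> = real (card (?\<Omega> \<inter> (\<lambda>\<sigma>. \<sigma> e) -` {c})) / real (card ?\<Omega>)"
    using fin by (simp add: measure_pmf_of_set)
  also have "?\<Omega> \<inter> (\<lambda>\<sigma>. \<sigma> e) -` {c} = {\<sigma> \<in> ?\<Omega>. \<sigma> e = c}" by auto
  finally show "pmf (pinned_marginal q E \<Lambda> \<tau> e) c = coloring_weight q \<Lambda> \<tau> e E c / T"
    by (simp add: T coloring_weight_def \<Omega>)
qed

section \<open>From branch weights to the mixing bound\<close>

context tree
begin

text \<open>Both sides of \<open>e\<close> deviate by at most \<open>\<rho> ^ (K - 2)\<close>.
  Multiplying them costs a factor 4 and normalizing a factor 2.\<close>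

lemma pinned_marginal_near_uniform:
  fixes \<rho> :: real
  defines "\<rho> \<equiv> 2 * real (max_degree V E) / (2 * real (max_degree V E) + 1)"
  assumes \<Delta>: "max_degree V E \<ge> 2" and q: "q \<ge> 2 * max_degree V E - 1"
    and e: "e \<in> E" and \<Lambda>: "\<Lambda> \<subseteq> E - {e}" and d: "\<And>f. f \<in> \<Lambda> \<Longrightarrow> K \<le> edge_dist V E e f"
    and \<tau>: "\<tau> \<in> feasible_pinnings q E \<Lambda>" and \<rho>: "\<rho> ^ (K - 2) \<le> 1 / 2"
  shows "(\<Sum>c\<in>{1..q}. \<bar>pmf (pinned_marginal q E \<Lambda> \<tau> e) c - 1 / real q\<bar>) \<le> 8 * \<rho> ^ (K - 2)"
proof -
  obtain u v where uv: "e = {u, v}" using edge_card[OF e] by (auto simp: card_2_iff)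
  have uvE: "{u, v} \<in> E" "{u, v} \<notin> \<Lambda>" "{v, u} \<in> E" "{v, u} \<notin> \<Lambda>"
    using e \<Lambda> uv by (auto simp: insert_commute)
  have free1: "path_edges (u # v # xs) \<inter> \<Lambda> = {}" if "is_path V E (u # v # xs)" "length xs < Suc K" for xs
    by (rule free_of_edge_dist[OF uvE(1,2) _ that(1), of K]) (use d that(2) uv in auto)
  have free2: "path_edges (v # u # xs) \<inter> \<Lambda> = {}" if "is_path V E (v # u # xs)" "length xs < Suc K" for xs
    by (rule free_of_edge_dist[OF uvE(3,4) _ that(1), of K]) (use d that(2) uv in \<open>auto simp: insert_commute\<close>)
  let ?a = "coloring_weight q \<Lambda> \<tau> {v, u} (branch V E v u)"
  let ?b = "coloring_weight q \<Lambda> \<tau> {u, v} (branch V E u v)"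
  let ?N = "coloring_weight q \<Lambda> \<tau> e E"
  have b: "mixing_weight (max_degree V E) q (Suc K) ?b"
    by (rule mixing_weight_branch[OF \<Delta> q uvE(1) free1])
  have a: "mixing_weight (max_degree V E) q (Suc K) ?a"
    by (rule mixing_weight_branch[OF \<Delta> q uvE(3) free2])
  \<comment> \<open>Each side has \<open>Suc K\<close> unpinned levels, because \<open>e\<close>
    itself is the first one.\<close>
  have K: "Suc K - 3 = K - 2" by simp
  have \<rho>0: "0 \<le> \<rho> ^ (K - 2)" by (simp add: \<rho>_def)
  have "\<bar>?N c - ?N c'\<bar> \<le> (4 * \<rho> ^ (K - 2)) * (?N c + ?N c')" if "c \<in> {1..q}" "c' \<in> {1..q}" for c c'
  proof -
    have "\<bar>?a c - ?a c'\<bar> \<le> \<rho> ^ (K - 2) * (?a c + ?a c')" "\<bar>?b c - ?b c'\<bar> \<le> \<rho> ^ (K - 2) * (?b c + ?b c')"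
      using a b that unfolding mixing_weight_def \<rho>_def K by blast+
    then show ?thesis
      using product_deviation[OF _ _ _ _ \<rho>0 \<rho>] coloring_weight_edge[OF uvE(1,2)] that
      by (simp add: coloring_weight_nonneg uv)
  qed
  moreover have "q > 0" using q \<Delta> by simp
  moreover have "\<Lambda> \<subseteq> E" using \<Lambda> by auto
  ultimately have "(\<Sum>c\<in>{1..q}. \<bar>?N c / sum ?N {1..q} - 1 / real q\<bar>) \<le> 2 * (4 * \<rho> ^ (K - 2))"
    using pmf_pinned_marginal(2)[OF finite_E \<tau> _ e] by (intro near_uniform) auto
  then show ?thesis using pmf_pinned_marginal(1)[OF finite_E \<tau> \<open>\<Lambda> \<subseteq> E\<close> e] by simp
qed

lemma tv_dist_pinned_marginals:
  fixes \<rho> :: real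
  defines "\<rho> \<equiv> 2 * real (max_degree V E) / (2 * real (max_degree V E) + 1)"
  assumes \<Delta>: "max_degree V E \<ge> 2" and q: "q \<ge> 2 * max_degree V E - 1"
    and e: "e \<in> E" and \<Lambda>: "\<Lambda> \<subseteq> E - {e}" and d: "\<And>f. f \<in> \<Lambda> \<Longrightarrow> K \<le> edge_dist V E e f"
    and \<sigma>: "\<sigma> \<in> feasible_pinnings q E \<Lambda>" and \<tau>: "\<tau> \<in> feasible_pinnings q E \<Lambda>"
  shows "tv_dist (pinned_marginal q E \<Lambda> \<sigma> e) (pinned_marginal q E \<Lambda> \<tau> e) \<le> 16 * \<rho> ^ (K - 2)"
\<comment> \<open>If the power exceeds 1/2, the claimed bound exceeds 8 and total variation distance
  is at most 1. Otherwise compare both marginals with the uniform distribution.\<close>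
proof (cases "\<rho> ^ (K - 2) \<le> 1 / 2")
  case False
  then show ?thesis using tv_dist_le_1[of "pinned_marginal q E \<Lambda> \<sigma> e" "pinned_marginal q E \<Lambda> \<tau> e"]
    by linarith
next
  case True
  let ?p = "pmf (pinned_marginal q E \<Lambda> \<sigma> e)" and ?r = "pmf (pinned_marginal q E \<Lambda> \<tau> e)"
  have "set_pmf (pinned_marginal q E \<Lambda> \<sigma> e) \<subseteq> {1..q}" if "\<sigma> \<in> feasible_pinnings q E \<Lambda>" for \<sigma>
    using e by (auto simp: set_pmf_pinned_marginal[OF finite_E that] proper_colorings_def PiE_iff)
  then have "tv_dist (pinned_marginal q E \<Lambda> \<sigma> e) (pinned_marginal q E \<Lambda> \<tau> e) \<le> (\<Sum>c\<in>{1..q}. \<bar>?p c - ?r c\<bar>)"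
    using \<sigma> \<tau> by (intro tv_dist_le_sum) auto
  also have "\<dots> \<le> (\<Sum>c\<in>{1..q}. \<bar>?p c - 1 / real q\<bar> + \<bar>?r c - 1 / real q\<bar>)"
    by (intro sum_mono) linarith
  also have "\<dots> \<le> 8 * \<rho> ^ (K - 2) + 8 * \<rho> ^ (K - 2)"
    unfolding sum.distrib \<rho>_def
    by (intro add_mono pinned_marginal_near_uniform \<Delta> q e \<Lambda> d \<sigma> \<tau> True[unfolded \<rho>_def])
  finally show ?thesis by simp
qed

text \<open>Greedy coloring: an edge meets at most \<Delta> - 1 others at each endpoint, fewer than
  \<open>q\<close> in total.\<close>

lemma proper_colorings_nonempty:
  assumes q: "q \<ge> 2 * max_degree V E - 1" "q \<ge> 1"
  shows "proper_colorings q E \<noteq> {}"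
proof -
  have "finite F \<Longrightarrow> F \<subseteq> E \<Longrightarrow> proper_colorings q F \<noteq> {}" for F
  proof (induction F rule: finite_induct)
    case empty
    then show ?case by (auto simp: proper_colorings_def)
  next
    case (insert f F)
    then obtain \<sigma> where \<sigma>: "\<sigma> \<in> proper_colorings q F" by auto
    have f: "f \<in> E" using insert.prems by simp
    obtain x y where xy: "f = {x, y}" using edge_card[OF f] by (auto simp: card_2_iff)
    let ?N = "{g \<in> F. g \<inter> f \<noteq> {}}"
    have deg: "card ({g \<in> E. z \<in> g} - {f}) \<le> max_degree V E - 1" if z: "z \<in> f" for z
    proof -
      have "z \<in> V" using edge_subset[OF f] z by auto
      then have "card {g \<in> E. z \<in> g} \<le> max_degree V E"
        using finite_V by (auto simp: max_degree_def vertex_degree_def intro!: Max_ge)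
      then show ?thesis using z f finite_E by (simp add: card_Diff_singleton)
    qed
    have "card ?N \<le> card (({g \<in> E. x \<in> g} - {f}) \<union> ({g \<in> E. y \<in> g} - {f}))"
      using insert finite_E xy by (intro card_mono) auto
    also have "\<dots> \<le> (max_degree V E - 1) + (max_degree V E - 1)"
      using xy by (intro order_trans[OF card_Un_le] add_mono deg) auto
    also have "\<dots> < q" using q by linarith
    finally have "card (\<sigma> ` ?N) < card {1..q}"
      using card_image_le[of ?N \<sigma>] insert.hyps(1) by simp
    moreover have "finite (\<sigma> ` ?N)" using insert.hyps(1) by simp
    ultimately have "\<not> {1..q} \<subseteq> \<sigma> ` ?N" using card_mono linorder_not_le by blast
    then obtain c where c: "c \<in> {1..q}" "c \<notin> \<sigma> ` ?N" by blast
    have "\<sigma>(f := c) \<in> proper_colorings q (insert f F)"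
      using \<sigma> c insert.hyps(2) unfolding proper_colorings_def
      by (auto simp: PiE_iff extensional_def Int_commute image_iff)
    then show ?case by blast
  qed
  then show ?thesis using finite_E by blast
qed

end

lemma weak_spatial_mixing_tree:
  fixes \<Delta> q :: nat and \<gamma> :: real
  assumes tree: "is_tree V E" and \<Delta>: "max_degree V E = \<Delta>" "\<Delta> \<ge> 2" and q: "q \<ge> 2 * \<Delta> - 1"
    and \<gamma>: "\<gamma> \<le> 1 / (2 * real \<Delta> + 1)"
  shows "weak_spatial_mixing q V E \<gamma> (16 / (2 * real \<Delta> / (2 * real \<Delta> + 1))\<^sup>2)"
proof -
  interpret tree V E using tree by (simp add: tree_def)
  define \<rho> where "\<rho> = 2 * real \<Delta> / (2 * real \<Delta> + 1)"
  have \<rho>: "0 < \<rho>" "\<rho> \<le> 1" "\<rho> \<le> 1 - \<gamma>" using \<Delta>(2) \<gamma> by (auto simp: \<rho>_def field_simps)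
  have "tv_dist (pinned_marginal q E \<Lambda> \<sigma> e) (pinned_marginal q E \<Lambda> \<tau> e)
      \<le> 16 / \<rho>\<^sup>2 * (1 - \<gamma>) ^ Min (edge_dist V E e ` \<Lambda>)"
    if e: "e \<in> E" and \<Lambda>: "\<Lambda> \<subseteq> E - {e}" and \<sigma>: "\<sigma> \<in> feasible_pinnings q E \<Lambda>"
      and \<tau>: "\<tau> \<in> feasible_pinnings q E \<Lambda>" for e \<Lambda> \<sigma> \<tau>
  proof -
    define K where "K = Min (edge_dist V E e ` \<Lambda>)"
    have "finite \<Lambda>" using \<Lambda> finite_E by (meson finite_Diff finite_subset)
    then have d: "K \<le> edge_dist V E e f" if "f \<in> \<Lambda>" for f
      using that by (simp add: K_def)
    have "tv_dist (pinned_marginal q E \<Lambda> \<sigma> e) (pinned_marginal q E \<Lambda> \<tau> e) \<le> 16 * \<rho> ^ (K - 2)"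
      using tv_dist_pinned_marginals[OF _ _ e \<Lambda> d \<sigma> \<tau>] \<Delta> q by (simp add: \<rho>_def)
    \<comment> \<open>Also for \<open>K < 2\<close>, where the subtraction truncates: (K - 2) + 2 is
      at least \<open>K\<close> and \<rho> is at most 1.\<close>
    also have "\<rho> ^ (K - 2) \<le> \<rho> ^ K / \<rho>\<^sup>2"
    proof -
      have "\<rho> ^ (K - 2) * \<rho>\<^sup>2 \<le> \<rho> ^ K"
        unfolding power_add[symmetric] using \<rho> by (intro power_decreasing) auto
      then show ?thesis using \<rho> by (simp add: pos_le_divide_eq)
    qed
    also have "\<rho> ^ K \<le> (1 - \<gamma>) ^ K" using \<rho> by (intro power_mono) auto
    finally show ?thesis using \<rho> by (simp add: K_def divide_right_mono mult_left_mono)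
  qed
  moreover have "proper_colorings q E \<noteq> {}" using q \<Delta> by (intro proper_colorings_nonempty) auto
  ultimately show ?thesis unfolding weak_spatial_mixing_def \<rho>_def by blast
qed

section \<open>Frozen trees below the threshold\<close>

text \<open>A rooted tree of depth \<open>n\<close> in which every vertex of level \<open>k < n\<close> has \<open>a k\<close> children, numbered by
  \<open>idx\<close>. An edge is identified with its lower endpoint.\<close>

locale level_tree =
  fixes V :: "'v set" and root :: 'v and par :: "'v \<Rightarrow> 'v" and lev idx :: "'v \<Rightarrow> nat"
    and a :: "nat \<Rightarrow> nat" and n :: nat
  assumes finite_V: "finite V" and root: "root \<in> V" and lev_root: "lev root = 0"
    and par: "v \<in> V - {root} \<Longrightarrow> par v \<in> V" and lev_par: "v \<in> V - {root} \<Longrightarrow> lev v = Suc (lev (par v))"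
    and idx: "v \<in> V - {root} \<Longrightarrow> idx v < a (lev (par v))"
    and lev_le: "v \<in> V \<Longrightarrow> lev v \<le> n"
    and child: "u \<in> V \<Longrightarrow> lev u < n \<Longrightarrow> x < a (lev u) \<Longrightarrow> \<exists>v\<in>V - {root}. par v = u \<and> idx v = x"
    and child_inj: "v \<in> V - {root} \<Longrightarrow> w \<in> V - {root} \<Longrightarrow> par v = par w \<Longrightarrow> idx v = idx w \<Longrightarrow> v = w"
begin

definition ed :: "'v \<Rightarrow> 'v set" where "ed v = {v, par v}"

definition edges :: "'v set set" where "edges = ed ` (V - {root})"

definition children :: "'v \<Rightarrow> 'v set" where "children u = {v \<in> V - {root}. par v = u}"

text \<open>Two vertices with the same edge would be parents of each other, against the
  levels.\<close>

lemma inj_ed: "inj_on ed (V - {root})"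
proof (rule inj_onI)
  fix v w assume vw: "v \<in> V - {root}" "w \<in> V - {root}" "ed v = ed w"
  show "v = w"
  proof (rule ccontr)
    assume "v \<noteq> w"
    then have "v = par w" "w = par v" using vw(3) by (auto simp: ed_def doubleton_eq_iff)
    then have "lev v = Suc (lev w)" "lev w = Suc (lev v)" using vw lev_par by metis+
    then show False by simp
  qed
qed

lemma edge_cases:
  assumes "{x, y} \<in> edges"
  obtains "x \<in> V - {root}" "y = par x" | "y \<in> V - {root}" "x = par y"
proof -
  obtain v where "v \<in> V - {root}" "{x, y} = {v, par v}" using assms unfolding edges_def ed_def by blast
  then show ?thesis using that by (auto simp only: doubleton_eq_iff)
qed

lemma ed_in_edges: "v \<in> V - {root} \<Longrightarrow> ed v \<in> edges"
  by (auto simp: edges_def)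

lemma finite_edges: "finite edges" using finite_V by (simp add: edges_def)

section \<open>The level tree is a tree\<close>

lemma simple_graph: "simple_graph V edges"
proof -
  have "card (ed v) = 2" if "v \<in> V - {root}" for v
  proof -
    have "v \<noteq> par v" using lev_par[OF that] by auto
    then show ?thesis by (simp add: ed_def)
  qed
  then show ?thesis using root finite_V par by (auto simp: simple_graph_def edges_def ed_def)
qed

lemma path_step:
  assumes p: "is_path V edges p" "hd p = x" "last p = y" and e: "{y, z} \<in> edges"
  shows "\<exists>p. is_path V edges p \<and> hd p = x \<and> last p = z"
proof (cases "z \<in> set p")
  case True
  then obtain R S where RS: "p = R @ z # S" by (meson split_list)
  then have "is_path V edges ((R @ [z]) @ S)" using p(1) by simp
  then have "is_path V edges (R @ [z])" by (rule is_path_prefix) simp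
  moreover have "hd (R @ [z]) = x" using RS p(2) by (cases R) auto
  ultimately show ?thesis by (metis last_snoc)
next
  case False
  have ne: "p \<noteq> []" using p(1) by (simp add: is_path_def)
  have "z \<in> V" using e simple_graph by (auto simp: simple_graph_def)
  then have "is_path V edges [z]" by (simp add: is_path_def)
  then have "is_path V edges (p @ [z])" using ne p e False by (subst is_path_append_iff) auto
  then show ?thesis using ne p(2) by (metis hd_append2 last_snoc)
qed

lemma path_from:
  assumes u: "\<exists>p. is_path V edges p \<and> hd p = u \<and> last p = root" and "v \<in> V"
  shows "\<exists>p. is_path V edges p \<and> hd p = u \<and> last p = v"
  using assms(2)
proof (induction "lev v" arbitrary: v rule: less_induct)
  case less
  show ?case
  proof (cases "v = root")
    case False
    then have v: "v \<in> V - {root}" using less.prems by simp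
    then have "\<exists>p. is_path V edges p \<and> hd p = u \<and> last p = par v"
      using less.hyps[of "par v"] lev_par par by simp
    moreover have "{par v, v} \<in> edges" using ed_in_edges[OF v] by (simp add: ed_def insert_commute)
    ultimately show ?thesis using path_step by blast
  qed (use u in simp)
qed

lemma connected: "graph_connected V edges"
  unfolding graph_connected_def
proof (intro ballI)
  fix u v assume uv: "u \<in> V" "v \<in> V"
  have "is_path V edges [root]" using root by (simp add: is_path_def)
  then have "\<exists>p. is_path V edges p \<and> hd p = root \<and> last p = root" by (metis last.simps list.sel(1))
  then obtain p where p: "is_path V edges p" "hd p = root" "last p = u" using path_from uv(1) by blast
  then have "is_path V edges (rev p)" "hd (rev p) = u" "last (rev p) = root"
    by (auto simp: hd_rev last_rev)
  then show "\<exists>p. is_path V edges p \<and> hd p = u \<and> last p = v" using path_from uv(2) by blast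
qed

text \<open>A vertex of maximal level on a cycle has two distinct neighbors there, and both would
  have to be its parent.\<close>

lemma acyclic: "graph_acyclic V edges"
  unfolding graph_acyclic_def
proof
  assume "\<exists>p. is_path V edges p \<and> length p \<ge> 3 \<and> {last p, hd p} \<in> edges"
  then obtain p where p: "is_path V edges p" "length p \<ge> 3" "{last p, hd p} \<in> edges" by blast
  then have ne: "p \<noteq> []" by auto
  have e: "{p ! i, p ! Suc i} \<in> edges" if "Suc i < length p" for i
    using p(1) that by (auto simp: is_path_def path_edges_def)
  have e0: "{p ! (length p - 1), p ! 0} \<in> edges" using p(3) ne by (simp add: last_conv_nth hd_conv_nth)
  have "Max (lev ` set p) \<in> lev ` set p" using ne by (intro Max_in) auto
  then obtain x where "x \<in> set p" "lev x = Max (lev ` set p)" by auto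
  then have x: "x \<in> set p" "\<And>y. y \<in> set p \<Longrightarrow> lev y \<le> lev x" by simp_all
  then obtain i where i: "i < length p" "p ! i = x" by (auto simp: in_set_conv_nth)
  \<comment> \<open>The neighbors along the cycle; at the two ends of \<open>p\<close> the closing
    edge supplies one of them.\<close>
  have "\<exists>j k. j < length p \<and> k < length p \<and> j \<noteq> k \<and> {p ! i, p ! j} \<in> edges \<and> {p ! i, p ! k} \<in> edges"
  proof -
    consider "i = 0" | "i = length p - 1" "i > 0" | "0 < i" "Suc i < length p" using i(1) by linarith
    then show ?thesis
    proof cases
      case 1
      then show ?thesis using e[of 0] e0 p(2)
        by (intro exI[of _ 1] exI[of _ "length p - 1"]) (auto simp: insert_commute)
    next
      case 2
      then show ?thesis using e[of "length p - 2"] e0 p(2)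
        by (intro exI[of _ 0] exI[of _ "length p - 2"]) (auto simp: insert_commute Suc_diff_Suc numeral_2_eq_2)
    next
      case 3
      then show ?thesis using e[of "i - 1"] e[of i]
        by (intro exI[of _ "i - 1"] exI[of _ "Suc i"]) (auto simp: insert_commute)
    qed
  qed
  then obtain j k where jk: "j < length p" "k < length p" "j \<noteq> k" "{x, p ! j} \<in> edges" "{x, p ! k} \<in> edges"
    using i(2) by blast
  have up: "y = par x" if "{x, y} \<in> edges" "y \<in> set p" for y
    using that(1) by (rule edge_cases) (use lev_par x(2)[OF that(2)] in fastforce)+
  have "p ! j = p ! k" using up[OF jk(4)] up[OF jk(5)] jk by simp
  then show False using jk p(1) by (simp add: is_path_def nth_eq_iff_index_eq)
qed

lemma is_tree: "is_tree V edges"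
  by (simp add: is_tree_def simple_graph connected acyclic)

section \<open>Children and degrees\<close>

lemma finite_children: "finite (children u)"
  using finite_V by (simp add: children_def)

lemma inj_idx_children: "inj_on idx (children u)"
  by (rule inj_onI) (auto simp: children_def intro: child_inj)

lemma idx_children_subset: "idx ` children u \<subseteq> {..<a (lev u)}"
  using idx by (auto simp: children_def)

lemma card_children_le: "card (children u) \<le> a (lev u)"
  using card_inj_on_le[OF inj_idx_children idx_children_subset] by simp

lemma card_children:
  assumes "u \<in> V" "lev u < n"
  shows "card (children u) = a (lev u)"
proof -
  have "idx ` children u = {..<a (lev u)}"
    using child[OF assms] idx_children_subset by (fastforce simp: children_def)
  then show ?thesis using card_image[OF inj_idx_children, of u] by simp
qed

lemma incident_edges:
  assumes "v \<in> V - {root}"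
  shows "{e \<in> edges. v \<in> e} = ed ` insert v (children v)"
  using assms by (auto simp: edges_def ed_def children_def)

lemma incident_edges_root: "{e \<in> edges. root \<in> e} = ed ` children root"
  by (auto simp: edges_def ed_def children_def)

lemma vertex_degree:
  assumes v: "v \<in> V - {root}"
  shows "vertex_degree edges v = Suc (card (children v))"
proof -
  have "v \<notin> children v" using lev_par[OF v] by (auto simp: children_def)
  moreover have "inj_on ed (insert v (children v))"
    by (rule inj_on_subset[OF inj_ed]) (use v in \<open>auto simp: children_def\<close>)
  ultimately show ?thesis
    unfolding vertex_degree_def incident_edges[OF v] using finite_children by (simp add: card_image)
qed

lemma vertex_degree_root: "vertex_degree edges root \<le> a 0"
proof -
  have "vertex_degree edges root \<le> card (children root)"
    unfolding vertex_degree_def incident_edges_root using finite_children by (rule card_image_le)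
  then show ?thesis using card_children_le[of root] lev_root by simp
qed

lemma level_nonempty:
  assumes "\<And>k. 0 < a k" "k \<le> n"
  shows "\<exists>v\<in>V. lev v = k"
  using assms(2)
proof (induction k)
  case 0
  then show ?case using root lev_root by blast
next
  case (Suc k)
  then obtain u where u: "u \<in> V" "lev u = k" by auto
  then obtain v where "v \<in> V - {root}" "par v = u"
    using child[of u 0] assms(1) Suc.prems by auto
  then show ?case using u lev_par by auto
qed

text \<open>The maximum is attained at level 1, where a vertex has all its \<open>a 1\<close>
  children because the depth is at least 2.\<close>

lemma max_degree:
  assumes "a 0 \<le> \<Delta>" "\<And>k. 0 < k \<Longrightarrow> Suc (a k) \<le> \<Delta>" "Suc (a 1) = \<Delta>" "\<And>k. 0 < a k" "2 \<le> n"
  shows "max_degree V edges = \<Delta>"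
proof -
  have le: "vertex_degree edges v \<le> \<Delta>" if "v \<in> V" for v
  proof (cases "v = root")
    case True
    then show ?thesis using vertex_degree_root assms(1) by simp
  next
    case False
    then have v: "v \<in> V - {root}" using that by simp
    show ?thesis using vertex_degree[OF v] card_children_le[of v] assms(2)[of "lev v"] lev_par[OF v] by simp
  qed
  obtain v where v: "v \<in> V" "lev v = 1" using level_nonempty[of 1] assms(4,5) by auto
  then have "v \<in> V - {root}" using lev_root by auto
  then have "vertex_degree edges v = \<Delta>"
    using vertex_degree card_children[of v] v assms(3,5) by simp
  then show ?thesis unfolding max_degree_def
    using v le finite_V by (intro Max_eqI) auto
qed

text \<open>Every step changes the level by one, so climbing down takes at least as many edges as
  levels.\<close>

lemma path_lev: "is_path V edges p \<Longrightarrow> lev (last p) \<le> lev (hd p) + path_length p"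
proof (induction p)
  case Nil
  then show ?case by (simp add: is_path_def)
next
  case (Cons x p)
  show ?case
  proof (cases p)
    case Nil
    then show ?thesis by simp
  next
    case (Cons y ys)
    then have p: "is_path V edges p" "{x, y} \<in> edges" using Cons.prems by (auto simp: is_path_Cons2)
    have "lev y \<le> Suc (lev x)" using p(2) by (rule edge_cases) (use lev_par in fastforce)+
    then show ?thesis using Cons.IH[OF p(1)] Cons by (simp add: path_length_def)
  qed
qed

text \<open>As the root has a single child \<open>r\<close>, everything else descends from
  \<open>r\<close>. The level bounds ensure that the path avoids the root and all deeper
  vertices.\<close>

lemma path_down:
  assumes a0: "a 0 = 1" and r: "r \<in> V" "lev r = 1" and v: "v \<in> V" "0 < lev v"
  shows "\<exists>p. is_path V edges p \<and> hd p = r \<and> last p = v \<and> (\<forall>z\<in>set p. 0 < lev z \<and> lev z \<le> lev v)"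
  using v
proof (induction "lev v" arbitrary: v)
  case 0
  then show ?case by simp
next
  case (Suc k)
  have v: "v \<in> V - {root}" using Suc.prems lev_root by auto
  show ?case
  proof (cases "k = 0")
    case True
    have rr: "r \<in> V - {root}" using r lev_root by auto
    have lev0: "x = root" if "x \<in> V" "lev x = 0" for x using lev_par[of x] that by auto
    have "par v = root" "par r = root"
      using lev0 par lev_par[OF v] lev_par[OF rr] v rr r(2) Suc.hyps(2) True by simp_all
    moreover have "idx v = idx r" using idx[OF v] idx[OF rr] calculation a0 lev_root by simp
    ultimately have "v = r" using child_inj[OF v rr] by simp
    then show ?thesis using r by (intro exI[of _ "[r]"]) (auto simp: is_path_def)
  next
    case False
    have "k = lev (par v)" using lev_par[OF v] Suc.hyps(2) by simp
    then obtain p where p: "is_path V edges p" "hd p = r" "last p = par v"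
      "\<forall>z\<in>set p. 0 < lev z \<and> lev z \<le> lev (par v)"
      using Suc.hyps(1)[of "par v"] par[OF v] False by auto
    have ne: "p \<noteq> []" using p(1) by (simp add: is_path_def)
    have "v \<notin> set p" using p(4) lev_par[OF v] by force
    moreover have "is_path V edges [v]" using v by (simp add: is_path_def)
    moreover have "{par v, v} \<in> edges" using ed_in_edges[OF v] by (simp add: ed_def insert_commute)
    ultimately have "is_path V edges (p @ [v])"
      using ne p by (subst is_path_append_iff) auto
    moreover have "\<forall>z\<in>set (p @ [v]). 0 < lev z \<and> lev z \<le> lev v" using p(4) lev_par[OF v] by fastforce
    ultimately show ?thesis using ne p(2) by (intro exI[of _ "p @ [v]"]) auto
  qed
qed

text \<open>A connecting path starts at level at most 1 and ends at level at least
  \<open>n - 1\<close>.\<close>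

lemma edge_dist_lower:
  assumes a0: "a 0 = 1" and n: "2 \<le> n" and r: "r \<in> V" "lev r = 1" and v: "v \<in> V" "lev v = n"
  shows "n - 2 \<le> edge_dist V edges (ed r) (ed v)"
proof -
  have vr: "v \<in> V - {root}" "r \<in> V - {root}" using v r n lev_root by auto
  have lp: "lev (par v) = n - 1" using lev_par[OF vr(1)] v by simp
  have lr: "lev (par r) = 0" using lev_par[OF vr(2)] r by simp
  let ?Q = "\<lambda>k p. is_path V edges p \<and> hd p \<in> ed r \<and> last p \<in> ed v \<and>
     ed r \<notin> path_edges p \<and> ed v \<notin> path_edges p \<and> path_length p = k"
  obtain p where p: "is_path V edges p" "hd p = r" "last p = par v"
      "\<forall>z\<in>set p. 0 < lev z \<and> lev z \<le> lev (par v)"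
    using path_down[OF a0 r, of "par v"] par[OF vr(1)] lp n by auto
  have "par r \<notin> set p" "v \<notin> set p" using p(4) lr lev_par[OF vr(1)] by force+
  then have "ed r \<notin> path_edges p" "ed v \<notin> path_edges p"
    using path_edges_subset_set[of _ p] unfolding ed_def by blast+
  then have "?Q (path_length p) p" using p by (simp add: ed_def)
  \<comment> \<open>The \<open>LEAST\<close> in the distance is attained only if some admissible
    path exists; \<open>p\<close> is one.\<close>
  then have "\<exists>q. ?Q (edge_dist V edges (ed r) (ed v)) q"
    unfolding edge_dist_def by (intro LeastI[of "\<lambda>k. \<exists>p. ?Q k p"]) blast
  then obtain q where q: "?Q (edge_dist V edges (ed r) (ed v)) q" by blast
  have "n - 1 \<le> lev (last q)" using q v lp by (auto simp: ed_def)
  moreover have "lev (hd q) \<le> 1" using q r lr by (auto simp: ed_def)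
  ultimately show ?thesis using path_lev[of q] q by simp
qed

text \<open>Siblings at one level exhaust the color set of that level, so the edge above them is
  forced into the complement; this propagates from the pinned bottom level to
  \<open>r\<close>.\<close>

lemma frozen_pinning:
  assumes n: "even n" "2 \<le> n" and r: "r \<in> V" "lev r = 1"
    and A: "A \<subseteq> {1..q}" and a0: "a 0 = 1"
    and aA: "\<And>k. odd k \<Longrightarrow> a k = card A"
    and aB: "\<And>k. even k \<Longrightarrow> 0 < k \<Longrightarrow> a k = card ({1..q} - A)" and B: "0 < card ({1..q} - A)"
  defines "\<Lambda> \<equiv> ed ` {v \<in> V. lev v = n}"
  shows "\<exists>\<tau>\<in>feasible_pinnings q edges \<Lambda>.
    \<forall>\<sigma>\<in>proper_colorings q edges \<inter> agreeing \<Lambda> \<tau>. \<sigma> (ed r) \<in> {1..q} - A"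
proof -
  define S where "S k = (if even k then A else {1..q} - A)" for k :: nat
  have finA: "finite A" using A finite_subset by blast
  obtain fA where fA: "bij_betw fA {..<card A} A"
    using ex_bij_betw_nat_finite[OF finA] by (auto simp: atLeast0LessThan)
  obtain fB where fB: "bij_betw fB {..<card ({1..q} - A)} ({1..q} - A)"
    using ex_bij_betw_nat_finite[of "{1..q} - A"] by (auto simp: atLeast0LessThan)
  define f where "f k = (if even k then fA else fB)" for k :: nat
  have f: "bij_betw (f k) {..<card (S k)} (S k)" for k using fA fB by (simp add: f_def S_def)
  have Sq: "S k \<subseteq> {1..q}" for k using A by (auto simp: S_def)
  have Ssuc: "S (Suc k) = {1..q} - S k" for k using A by (auto simp: S_def)
  \<comment> \<open>Each sibling group has exactly as many members as its color set, except below
    the root: there the only child has index 0, and \<open>B\<close> provides a color.\<close>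
  have idxS: "idx v < card (S (lev v))" if v: "v \<in> V - {root}" for v
    using idx[OF v] lev_par[OF v] aA[of "lev (par v)"] aB[of "lev (par v)"] a0 B
    by (cases "lev (par v) = 0") (auto simp: S_def)
  \<comment> \<open>An explicit coloring showing feasibility: the child with index \<open>i\<close>
    gets the \<open>i\<close>-th color of the set of its level.\<close>
  define \<sigma>0 where "\<sigma>0 = (\<lambda>x\<in>edges. let v = the_inv_into (V - {root}) ed x in f (lev v) (idx v))"
  have \<sigma>0: "\<sigma>0 (ed v) = f (lev v) (idx v)" if "v \<in> V - {root}" for v
    using that ed_in_edges[OF that] by (simp add: \<sigma>0_def the_inv_into_f_f[OF inj_ed])
  have \<sigma>0S: "\<sigma>0 (ed v) \<in> S (lev v)" if "v \<in> V - {root}" for v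
    using \<sigma>0[OF that] f[of "lev v"] idxS[OF that] by (auto simp: bij_betw_def)
  have vert: "v \<in> V - {root}" if "v \<in> V" "0 < lev v" for v using that lev_root by auto
  have adj: "\<sigma>0 (ed v) \<noteq> \<sigma>0 (ed w)"
    if v: "v \<in> V - {root}" and w: "w \<in> V - {root}" and neq: "v \<noteq> w" "ed v \<inter> ed w \<noteq> {}" for v w
  proof -
    consider "par v = par w" | "v = par w" | "w = par v"
      using neq by (auto simp: ed_def)
    then show ?thesis
    proof cases
      case 1
      then have lev: "lev v = lev w" using lev_par v w by metis
      have "idx v \<noteq> idx w" using child_inj[OF v w 1] neq(1) by blast
      then show ?thesis
        using \<sigma>0[OF v] \<sigma>0[OF w] lev idxS[OF v] idxS[OF w] f[of "lev v"]
        by (auto simp: bij_betw_def dest: inj_onD)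
    next
      case 2
      then have "lev w = Suc (lev v)" using lev_par[OF w] by simp
      then show ?thesis using \<sigma>0S[OF v] \<sigma>0S[OF w] Ssuc by auto
    next
      case 3
      then have "lev v = Suc (lev w)" using lev_par[OF v] by simp
      then show ?thesis using \<sigma>0S[OF v] \<sigma>0S[OF w] Ssuc by auto
    qed
  qed
  have "\<sigma>0 \<in> edges \<rightarrow>\<^sub>E {1..q}"
  proof (rule PiE_I)
    fix x assume "x \<in> edges"
    then show "\<sigma>0 x \<in> {1..q}" using subsetD[OF Sq \<sigma>0S] unfolding edges_def by blast
  qed (simp add: \<sigma>0_def)
  then have proper: "\<sigma>0 \<in> proper_colorings q edges"
    using adj unfolding proper_colorings_def edges_def by blast
  have \<Lambda>: "\<Lambda> \<subseteq> edges" using n vert ed_in_edges by (auto simp: \<Lambda>_def)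
  define \<tau> where "\<tau> = restrict \<sigma>0 \<Lambda>"
  have "\<sigma>0 \<in> agreeing \<Lambda> \<tau>" by (simp add: agreeing_def \<tau>_def)
  moreover have "\<tau> \<in> \<Lambda> \<rightarrow>\<^sub>E {1..q}" using \<Lambda> \<open>\<sigma>0 \<in> edges \<rightarrow>\<^sub>E {1..q}\<close> by (auto simp: \<tau>_def)
  ultimately have feas: "\<tau> \<in> feasible_pinnings q edges \<Lambda>"
    using proper by (auto simp: feasible_pinnings_def)
  have "\<sigma> (ed r) \<in> {1..q} - A" if \<sigma>: "\<sigma> \<in> proper_colorings q edges \<inter> agreeing \<Lambda> \<tau>" for \<sigma>
  proof -
    have range: "\<sigma> (ed v) \<in> {1..q}" if "v \<in> V - {root}" for v
      using \<sigma> ed_in_edges[OF that] by (auto simp: proper_colorings_def PiE_iff)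
    have distinct: "\<sigma> (ed v) \<noteq> \<sigma> (ed w)"
      if "v \<in> V - {root}" "w \<in> V - {root}" "v \<noteq> w" "ed v \<inter> ed w \<noteq> {}" for v w
      using \<sigma> that ed_in_edges inj_onD[OF inj_ed, of v w] unfolding proper_colorings_def by blast
    \<comment> \<open>Induction upwards from the pinned level \<open>n\<close>, which is even and
      hence carries \<open>A\<close>.\<close>
    have "\<sigma> (ed v) \<in> S (lev v)" if "v \<in> V" "0 < lev v" for v
      using that
    proof (induction "n - lev v" arbitrary: v)
      case 0
      then have "lev v = n" using lev_le[of v] by simp
      moreover then have "ed v \<in> \<Lambda>" using 0 by (auto simp: \<Lambda>_def)
      ultimately have "\<sigma> (ed v) = \<sigma>0 (ed v)" using \<sigma> by (auto simp: agreeing_def \<tau>_def)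
      then show ?case using \<sigma>0S vert 0 by simp
    next
      case (Suc k)
      have v: "v \<in> V - {root}" using vert Suc.prems by simp
      have lt: "lev v < n" using Suc.hyps(2) by simp
      have ch: "w \<in> V - {root}" "lev w = Suc (lev v)" "ed v \<inter> ed w \<noteq> {}" if "w \<in> children v" for w
        using that lev_par by (auto simp: children_def ed_def)
      have sub: "(\<sigma> \<circ> ed) ` children v \<subseteq> S (Suc (lev v))"
      proof clarify
        fix w assume w: "w \<in> children v"
        have "\<sigma> (ed w) \<in> S (lev w)"
          by (rule Suc.hyps(1)) (use ch[OF w] Suc.hyps(2) in auto)
        then show "(\<sigma> \<circ> ed) w \<in> S (Suc (lev v))" using ch[OF w] by simp
      qed
      have "inj_on (\<sigma> \<circ> ed) (children v)"
      proof (rule inj_onI, rule ccontr)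
        fix w w' assume w: "w \<in> children v" "w' \<in> children v" "(\<sigma> \<circ> ed) w = (\<sigma> \<circ> ed) w'" "w \<noteq> w'"
        then show False using distinct[of w w'] by (auto simp: children_def ed_def)
      qed
      then have "card ((\<sigma> \<circ> ed) ` children v) = a (lev v)"
        using card_image card_children[of v] v lt by fastforce
      also have "\<dots> = card (S (Suc (lev v)))"
        using aA[of "lev v"] aB[of "lev v"] Suc.prems by (auto simp: S_def)
      \<comment> \<open>Injectivity and equal cardinality: the children use up every color of their
        set, leaving \<open>S (lev v)\<close> for the edge above.\<close>
      finally have eq: "(\<sigma> \<circ> ed) ` children v = S (Suc (lev v))"
        using sub finite_subset[OF Sq] by (intro card_subset_eq) auto
      have "\<sigma> (ed v) \<notin> (\<sigma> \<circ> ed) ` children v"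
      proof
        assume "\<sigma> (ed v) \<in> (\<sigma> \<circ> ed) ` children v"
        then obtain w where w: "w \<in> children v" "\<sigma> (ed v) = \<sigma> (ed w)" by auto
        then have "v \<noteq> w" using ch(2)[OF w(1)] by auto
        then show False using distinct[OF v ch(1)[OF w(1)]] ch(3)[OF w(1)] w(2) by blast
      qed
      then show ?case using range[OF v] unfolding eq Ssuc by blast
    qed
    then show ?thesis using r by (force simp: S_def)
  qed
  then show ?thesis using feas by blast
qed

end

text \<open>A vertex is the list of child indices on the way from the root, most recent first; its
  parent is the tail and its level the length.\<close>

fun level_list :: "(nat \<Rightarrow> nat) \<Rightarrow> nat list \<Rightarrow> bool" where
  "level_list a [] = True"
| "level_list a (x # xs) = (x < a (length xs) \<and> level_list a xs)"

text \<open>Encoding the index lists as numbers places the tree on natural numbers; the bound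
  \<open>M\<close> makes it finite.\<close>

lemma level_tree_exists:
  fixes a :: "nat \<Rightarrow> nat"
  assumes "\<And>k. a k \<le> M"
  shows "\<exists>(V :: nat set) root par lev idx. level_tree V root par lev idx a n"
proof -
  let ?L = "{xs. level_list a xs \<and> length xs \<le> n}"
  have "set xs \<subseteq> {..<M}" if "level_list a xs" for xs
    using that assms by (induction xs) (auto intro: less_le_trans)
  then have "?L \<subseteq> {xs. set xs \<subseteq> {..<M} \<and> length xs \<le> n}" by auto
  then have fin: "finite ?L" using finite_lists_length_le[of "{..<M}" n] finite_subset by auto
  have "level_tree (list_encode ` ?L) (list_encode []) (\<lambda>x. list_encode (tl (list_decode x)))
      (\<lambda>x. length (list_decode x)) (\<lambda>x. hd (list_decode x)) a n"
  proof
    show "finite (list_encode ` ?L)" using fin by simp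
    show "list_encode [] \<in> list_encode ` ?L" by (intro imageI) simp
    show "length (list_decode (list_encode [])) = 0" by (simp only: list_encode_inverse list.size)
  next
    fix v assume "v \<in> list_encode ` ?L - {list_encode []}"
    then obtain xs where "v = list_encode xs" "xs \<in> ?L" "xs \<noteq> []" by blast
    then obtain y ys where v: "v = list_encode (y # ys)" "y # ys \<in> ?L" by (cases xs) auto
    show "list_encode (tl (list_decode v)) \<in> list_encode ` ?L"
      unfolding v(1) list_encode_inverse by (intro imageI) (use v(2) in auto)
    show "length (list_decode v) = Suc (length (list_decode (list_encode (tl (list_decode v)))))"
      unfolding v(1) list_encode_inverse by simp
    show "hd (list_decode v) < a (length (list_decode (list_encode (tl (list_decode v)))))"
      unfolding v(1) list_encode_inverse using v(2) by simp
  next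
    fix v assume "v \<in> list_encode ` ?L"
    then show "length (list_decode v) \<le> n" by auto
  next
    fix u x assume "u \<in> list_encode ` ?L" and lt: "length (list_decode u) < n" and x: "x < a (length (list_decode u))"
    then obtain xs where u: "u = list_encode xs" "xs \<in> ?L" by blast
    let ?v = "list_encode (x # xs)"
    have "?v \<in> list_encode ` ?L"
      by (intro imageI) (use u(2) lt x in \<open>auto simp only: u(1) list_encode_inverse level_list.simps list.size mem_Collect_eq\<close>)
    moreover have "?v \<noteq> list_encode []" by (metis list_encode_inverse list.distinct(1))
    moreover have "list_encode (tl (list_decode ?v)) = u \<and> hd (list_decode ?v) = x"
      unfolding list_encode_inverse u(1) by simp
    ultimately show "\<exists>v\<in>list_encode ` ?L - {list_encode []}. list_encode (tl (list_decode v)) = u \<and> hd (list_decode v) = x"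
      by blast
  next
    fix v w assume v: "v \<in> list_encode ` ?L - {list_encode []}" and w: "w \<in> list_encode ` ?L - {list_encode []}"
      and eq: "list_encode (tl (list_decode v)) = list_encode (tl (list_decode w))"
        "hd (list_decode v) = hd (list_decode w)"
    have "list_decode v \<noteq> []" "list_decode w \<noteq> []" using v w by (metis DiffD2 list_decode_inverse singletonI)+
    moreover have "tl (list_decode v) = tl (list_decode w)" using eq(1) by (metis list_encode_inverse)
    ultimately have "list_decode v = list_decode w" using eq(2) by (metis list.expand)
    then show "v = w" by (metis list_decode_inverse)
  qed
  then show ?thesis by blast
qed

lemma tv_dist_ge_1:
  assumes "set_pmf p \<subseteq> A" "set_pmf r \<inter> A = {}"
  shows "tv_dist p r \<ge> 1"
proof -
  have "measure_pmf.prob p A = 1"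
    using assms(1) by (subst measure_pmf.prob_eq_1) (auto simp: AE_measure_pmf_iff)
  moreover have "measure_pmf.prob r A = 0"
    using assms(2) by (simp add: measure_pmf_zero_iff)
  ultimately have "1 = \<bar>measure_pmf.prob p A - measure_pmf.prob r A\<bar>" by simp
  also have "\<dots> \<le> tv_dist p r"
    unfolding tv_dist_def
  proof (rule cSUP_upper)
    have "\<bar>measure_pmf.prob p B - measure_pmf.prob r B\<bar> \<le> 1" for B
      using measure_pmf.prob_le_1[of p B] measure_pmf.prob_le_1[of r B]
        measure_nonneg[of p B] measure_nonneg[of r B] by linarith
    then show "bdd_above (range (\<lambda>A. \<bar>measure_pmf.prob p A - measure_pmf.prob r A\<bar>))"
      by (intro bdd_aboveI[of _ 1]) auto
  qed simp
  finally show ?thesis .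
qed

text \<open>The single child of the root provides the top edge whose marginal is tested.\<close>

definition alternating :: "nat \<Rightarrow> nat \<Rightarrow> nat \<Rightarrow> nat" where
  "alternating s b k = (if k = 0 then 1 else if odd k then s else b)"

lemma no_weak_spatial_mixing:
  fixes \<Delta> q :: nat and C \<gamma> :: real
  assumes \<Delta>: "\<Delta> \<ge> 2" and q: "q \<le> 2 * \<Delta> - 2" and C: "C > 0" and \<gamma>: "0 < \<gamma>" "\<gamma> < 1"
  shows "\<exists>(V :: nat set) E. is_tree V E \<and> max_degree V E = \<Delta> \<and> \<not> weak_spatial_mixing q V E \<gamma> C"
proof -
  \<comment> \<open>The number of colors outside a set of \<Delta> - 1 colors. It is at most
    \<Delta> - 1 by the bound on \<open>q\<close>, which keeps degrees within \<Delta>;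
    \<open>max 1\<close> keeps every level nonempty when \<open>q < \<Delta>\<close>.\<close>
  define b where "b = max 1 (q + 1 - \<Delta>)"
  define a where "a = alternating (\<Delta> - 1) b"
  have a: "a 0 = 1" "0 < a k" "0 < k \<Longrightarrow> Suc (a k) \<le> \<Delta>" "Suc (a 1) = \<Delta>" for k
    using \<Delta> q by (auto simp: a_def alternating_def b_def)
  have "a k \<le> \<Delta>" for k using a(1) a(3)[of k] \<Delta> by (cases "k = 0") auto
  obtain m where m: "(1 - \<gamma>) ^ m < 1 / C"
    using real_arch_pow_inv[of "1 / C" "1 - \<gamma>"] C \<gamma> by auto
  \<comment> \<open>Even, as the freezing requires, and with \<open>n - 2\<close> at least
    \<open>m\<close>.\<close>
  define n where "n = 2 * m + 2"
  obtain V :: "nat set" and root par lev idx where "level_tree V root par lev idx a n"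
    using level_tree_exists[of a \<Delta> n] \<open>\<And>k. a k \<le> \<Delta>\<close> by blast
  then interpret level_tree V root par lev idx a n .
  have n: "even n" "2 \<le> n" by (auto simp: n_def)
  have deg: "max_degree V edges = \<Delta>" using max_degree[of \<Delta>] a \<Delta> n by simp
  obtain r where r: "r \<in> V" "lev r = 1" using level_nonempty[of 1] a(2) n by auto
  obtain l where l: "l \<in> V" "lev l = n" using level_nonempty[of n] a(2) by auto
  have rV: "r \<in> V - {root}" using r lev_root by auto
  have "\<not> weak_spatial_mixing q V edges \<gamma> C"
  proof (cases "q < \<Delta>")
    case True
    \<comment> \<open>The \<Delta> edges at \<open>r\<close> would need distinct colors.\<close>
    have "proper_colorings q edges = {}"
    proof (rule ccontr)
      assume "proper_colorings q edges \<noteq> {}"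
      then obtain \<sigma> where \<sigma>: "\<sigma> \<in> proper_colorings q edges" by auto
      let ?F = "{e \<in> edges. r \<in> e}"
      have "card ?F = \<Delta>"
        using vertex_degree[OF rV] card_children[OF r(1)] r(2) n a(4) by (simp add: vertex_degree_def)
      moreover have "inj_on \<sigma> ?F"
      proof (rule inj_onI, rule ccontr)
        fix e f assume "e \<in> ?F" "f \<in> ?F" "\<sigma> e = \<sigma> f" "e \<noteq> f"
        then show False using \<sigma> unfolding proper_colorings_def by blast
      qed
      moreover have "\<sigma> ` ?F \<subseteq> {1..q}" using \<sigma> by (auto simp: proper_colorings_def PiE_iff)
      ultimately have "\<Delta> \<le> q" using card_inj_on_le[of \<sigma> ?F "{1..q}"] by simp
      then show False using True by simp
    qed
    then show ?thesis by (simp add: weak_spatial_mixing_def)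
  next
    case False
    then have b: "b = q + 1 - \<Delta>" by (simp add: b_def)
    define \<Lambda> where "\<Lambda> = ed ` {v \<in> V. lev v = n}"
    have frozen: "\<exists>\<tau>\<in>feasible_pinnings q edges \<Lambda>.
        \<forall>\<sigma>\<in>proper_colorings q edges \<inter> agreeing \<Lambda> \<tau>. \<sigma> (ed r) \<in> {1..q} - A"
      if A: "A \<subseteq> {1..q}" "card A = \<Delta> - 1" for A
    proof -
      have "card ({1..q} - A) = b"
        using A False \<Delta> finite_subset[OF A(1)] by (simp add: card_Diff_subset b)
      then show ?thesis
        unfolding \<Lambda>_def using False A
        by (intro frozen_pinning[OF n r A(1) a(1)]) (auto simp: a_def alternating_def b)
    qed
    \<comment> \<open>The complements are the colors from \<Delta> to \<open>q\<close> and those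
      from 1 to \<open>b\<close>; they are disjoint because b < \<Delta>.\<close>
    have A1: "{1..\<Delta> - 1} \<subseteq> {1..q}" "card {1..\<Delta> - 1} = \<Delta> - 1" using False by auto
    have A2: "{b + 1..q} \<subseteq> {1..q}" "card {b + 1..q} = \<Delta> - 1" using False \<Delta> b by auto
    obtain \<tau> where \<tau>: "\<tau> \<in> feasible_pinnings q edges \<Lambda>"
      "\<forall>\<sigma>\<in>proper_colorings q edges \<inter> agreeing \<Lambda> \<tau>. \<sigma> (ed r) \<in> {1..q} - {1..\<Delta> - 1}"
      using frozen[OF A1] by blast
    obtain \<tau>' where \<tau>': "\<tau>' \<in> feasible_pinnings q edges \<Lambda>"
      "\<forall>\<sigma>\<in>proper_colorings q edges \<inter> agreeing \<Lambda> \<tau>'. \<sigma> (ed r) \<in> {1..q} - {b + 1..q}"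
      using frozen[OF A2] by blast
    have "1 \<le> tv_dist (pinned_marginal q edges \<Lambda> \<tau> (ed r)) (pinned_marginal q edges \<Lambda> \<tau>' (ed r))"
    proof (rule tv_dist_ge_1)
      show "set_pmf (pinned_marginal q edges \<Lambda> \<tau> (ed r)) \<subseteq> {1..q} - {1..\<Delta> - 1}"
        using \<tau>(2) unfolding set_pmf_pinned_marginal[OF finite_edges \<tau>(1)] by blast
      have "set_pmf (pinned_marginal q edges \<Lambda> \<tau>' (ed r)) \<subseteq> {1..q} - {b + 1..q}"
        using \<tau>'(2) unfolding set_pmf_pinned_marginal[OF finite_edges \<tau>'(1)] by blast
      moreover have "({1..q} - {b + 1..q}) \<inter> ({1..q} - {1..\<Delta> - 1}) = {}" using b q by auto
      ultimately show "set_pmf (pinned_marginal q edges \<Lambda> \<tau>' (ed r)) \<inter> ({1..q} - {1..\<Delta> - 1}) = {}"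
        by blast
    qed
    moreover have "C * (1 - \<gamma>) ^ Min (edge_dist V edges (ed r) ` \<Lambda>) < 1"
    proof -
      have "n - 2 \<le> Min (edge_dist V edges (ed r) ` \<Lambda>)"
        using l finite_V edge_dist_lower[OF a(1) n(2) r] by (subst Min_ge_iff) (auto simp: \<Lambda>_def)
      then have "m \<le> Min (edge_dist V edges (ed r) ` \<Lambda>)" by (simp add: n_def)
      then have "(1 - \<gamma>) ^ Min (edge_dist V edges (ed r) ` \<Lambda>) \<le> (1 - \<gamma>) ^ m"
        using \<gamma> by (intro power_decreasing) auto
      also have "\<dots> < 1 / C" by (rule m)
      finally show ?thesis using C by (simp add: field_simps)
    qed
    moreover have "ed r \<in> edges" using ed_in_edges[OF rV] .
    moreover have "\<Lambda> \<noteq> {}" using l by (auto simp: \<Lambda>_def)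
    moreover have "\<Lambda> \<subseteq> edges - {ed r}"
    proof
      fix x assume "x \<in> \<Lambda>"
      then obtain v where v: "x = ed v" "v \<in> V" "lev v = n" by (auto simp: \<Lambda>_def)
      then have vV: "v \<in> V - {root}" using lev_root n by auto
      moreover have "v \<noteq> r" using v r n by auto
      ultimately show "x \<in> edges - {ed r}"
        using v(1) ed_in_edges[OF vV] inj_onD[OF inj_ed _ vV rV] by auto
    qed
    ultimately show ?thesis
      using \<tau>(1) \<tau>'(1) unfolding weak_spatial_mixing_def by (meson not_less order_trans)
  qed
  then show ?thesis using is_tree deg by blast
qed

theorem theorem7p1:
  fixes \<Delta> q :: nat and \<epsilon> :: real
  assumes "\<Delta> \<ge> 2" and "q \<ge> 1"
    and "\<epsilon> = max ((real \<Delta> - 1) / real \<Delta>) ((exp 1 - 1) / exp 1)"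
  shows "(q \<ge> 2 * \<Delta> - 1 \<longrightarrow>
           (\<exists>C>0. \<forall>(V :: nat set) E. is_tree V E \<and> max_degree V E = \<Delta> \<longrightarrow>
              weak_spatial_mixing q V E ((1 - \<epsilon>) / (2 * real \<Delta> - (1 + \<epsilon>))) C)) \<and>
         (q \<le> 2 * \<Delta> - 2 \<longrightarrow>
           \<not> (\<exists>C \<gamma>. C > 0 \<and> 0 < \<gamma> \<and> \<gamma> < 1 \<and>
              (\<forall>(V :: nat set) E. is_tree V E \<and> max_degree V E = \<Delta> \<longrightarrow>
                 weak_spatial_mixing q V E \<gamma> C)))"
proof (intro conjI impI)
  assume q: "q \<ge> 2 * \<Delta> - 1"
  define x where "x = 1 - \<epsilon>"
  have "(real \<Delta> - 1) / real \<Delta> < 1" "(exp 1 - 1) / exp 1 < (1 :: real)"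
    using assms(1) by (simp_all add: field_simps)
  then have x0: "0 < x" by (simp add: x_def assms(3))
  have "(real \<Delta> - 1) / real \<Delta> \<le> \<epsilon>" by (simp add: assms(3))
  \<comment> \<open>The comparison of rates reduces to 2\<Delta>x \<le> 2\<Delta> - 2, which follows
    from \<Delta>x \<le> 1 and \<Delta> \<ge> 2.\<close>
  then have "real \<Delta> * x \<le> 1" using assms(1) by (simp add: x_def field_simps)
  then have "x * (2 * real \<Delta> + 1) \<le> 2 * real \<Delta> - 2 + x" using assms(1) by (simp add: algebra_simps)
  moreover have "0 < 2 * real \<Delta> - 2 + x" using assms(1) x0 by simp
  ultimately have "x / (2 * real \<Delta> - 2 + x) \<le> 1 / (2 * real \<Delta> + 1)"
    by (simp add: divide_le_eq field_simps)
  moreover have "(1 - \<epsilon>) / (2 * real \<Delta> - (1 + \<epsilon>)) = x / (2 * real \<Delta> - 2 + x)" by (simp add: x_def)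
  ultimately have \<gamma>: "(1 - \<epsilon>) / (2 * real \<Delta> - (1 + \<epsilon>)) \<le> 1 / (2 * real \<Delta> + 1)" by simp
  show "\<exists>C>0. \<forall>(V :: nat set) E. is_tree V E \<and> max_degree V E = \<Delta> \<longrightarrow>
      weak_spatial_mixing q V E ((1 - \<epsilon>) / (2 * real \<Delta> - (1 + \<epsilon>))) C"
    using weak_spatial_mixing_tree[OF _ _ assms(1) q \<gamma>] assms(1)
    by (intro exI[of _ "16 / (2 * real \<Delta> / (2 * real \<Delta> + 1))\<^sup>2"]) auto
next
  assume "q \<le> 2 * \<Delta> - 2"
  then show "\<not> (\<exists>C \<gamma>. C > 0 \<and> 0 < \<gamma> \<and> \<gamma> < 1 \<and>
      (\<forall>(V :: nat set) E. is_tree V E \<and> max_degree V E = \<Delta> \<longrightarrow> weak_spatial_mixing q V E \<gamma> C))"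
    using no_weak_spatial_mixing[OF assms(1)] by blast
qed

end
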